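(* Frobenius rank is an invariant of skew-equivalence: if $D_1,D_2$ are skew diagrams with $D_1\sim D_2$, then $D_1$ and $D_2$ have the same Frobenius rank. In particular, skew-equivalence restricts to the subset of ribbons (a skew diagram that is skew-equivalent to a ribbon is a ribbon), as the ribbons are the skew diagrams of Frobenius rank $1$.
   Context: A skew diagram $D=\lambda/\mu$ ($\mu\subseteq\lambda$ partitions, English notation) is the set of cells of $\lambda$ not in $\mu$, considered up to translation and insertion/removal of empty rows or columns. $s_D=\sum_Tx^T$ over column-strict fillings of $D$ by positive integers (rows weakly increasing, columns strictly increasing downward); $D_1\sim D_2$ (skew-equivalent) means $s_{D_1}=s_{D_2}$. $D$ is connected if it is not a disjoint union $D_1\oplus D_2$ of two proper subdiagrams sharing no row or column, $D_2$ lying north and east of $D_1$. A ribbon is a connected nonempty skew diagram containing no $2\times2$ block of cells. The (Durfee or) Frobenius rank of $D$ is the minimum number of ribbons in any decomposition of $D$ into ribbons. *)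

theory Defs
  imports Main "HOL-Library.FuncSet" "HOL-Library.Multiset" "HOL-Library.Disjoint_Sets"
begin

text \<open>
  English notation with indices starting at 0: the cell in row \<open>i\<close> (counted downwards) and
  column \<open>j\<close> (counted to the right) is the pair \<open>(i, j)\<close>. A partition is the infinite weakly
  decreasing sequence of its parts, padded with zeros.
\<close>

definition is_partition :: "(nat \<Rightarrow> nat) \<Rightarrow> bool" where
  "is_partition p \<longleftrightarrow> antimono p \<and> finite {i. p i \<noteq> 0}"

definition skew_cells :: "(nat \<Rightarrow> nat) \<Rightarrow> (nat \<Rightarrow> nat) \<Rightarrow> (nat \<times> nat) set" where
  "skew_cells l m = {(i, j). j < l i \<and> \<not> j < m i}"

text \<open>
  A skew diagram is represented by its set of cells. No quotient by translation and by insertion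
  or removal of empty rows and columns is formed: statements range over all representatives.
\<close>

definition skew_diagram :: "(nat \<times> nat) set \<Rightarrow> bool" where
  "skew_diagram D \<longleftrightarrow>
     (\<exists>l m. is_partition l \<and> is_partition m \<and> m \<le> l \<and> D = skew_cells l m)"

definition column_strict_fillings :: "(nat \<times> nat) set \<Rightarrow> (nat \<times> nat \<Rightarrow> nat) set" where
  "column_strict_fillings D =
     {T \<in> D \<rightarrow>\<^sub>E {1..}.
        (\<forall>i j j'. (i, j) \<in> D \<longrightarrow> (i, j') \<in> D \<longrightarrow> j < j' \<longrightarrow> T (i, j) \<le> T (i, j')) \<and>
        (\<forall>i i' j. (i, j) \<in> D \<longrightarrow> (i', j) \<in> D \<longrightarrow> i < i' \<longrightarrow> T (i, j) < T (i', j))}"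

text \<open>
  Monomials in the variables \<open>x\<^sub>1, x\<^sub>2, \<dots>\<close> are multisets of indices, so that \<open>x\<^sup>T\<close> is the
  multiset of entries of \<open>T\<close>.
\<close>

definition filling_monomial :: "(nat \<times> nat) set \<Rightarrow> (nat \<times> nat \<Rightarrow> nat) \<Rightarrow> nat multiset" where
  "filling_monomial D T = image_mset T (mset_set D)"

text \<open>
  The formal power series \<open>s\<^sub>D\<close>, given by its coefficients: the coefficient of a monomial \<open>a\<close>
  in \<open>\<Sum>\<^sub>T x\<^sup>T\<close> is the number of \<open>T\<close> with \<open>x\<^sup>T = a\<close>. For finite \<open>D\<close> only finitely many
  fillings have a given monomial.
\<close>

definition skew_schur :: "(nat \<times> nat) set \<Rightarrow> nat multiset \<Rightarrow> int" where
  "skew_schur D a = int (card {T \<in> column_strict_fillings D. filling_monomial D T = a})"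

definition skew_equivalent :: "(nat \<times> nat) set \<Rightarrow> (nat \<times> nat) set \<Rightarrow> bool" where
  "skew_equivalent D1 D2 \<longleftrightarrow> skew_schur D1 = skew_schur D2"

text \<open>
  \<open>D = D1 \<oplus> D2\<close>: row indices grow downwards, so north means a smaller first component. The
  strict inequalities say that \<open>D1\<close> and \<open>D2\<close> share no row or column and are disjoint.
\<close>

definition is_direct_sum ::
  "(nat \<times> nat) set \<Rightarrow> (nat \<times> nat) set \<Rightarrow> (nat \<times> nat) set \<Rightarrow> bool" where
  "is_direct_sum D D1 D2 \<longleftrightarrow>
     D = D1 \<union> D2 \<and> (\<forall>(i1, j1)\<in>D1. \<forall>(i2, j2)\<in>D2. i2 < i1 \<and> j1 < j2)"

definition connected_diagram :: "(nat \<times> nat) set \<Rightarrow> bool" where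
  "connected_diagram D \<longleftrightarrow>
     \<not> (\<exists>D1 D2. skew_diagram D1 \<and> skew_diagram D2 \<and> D1 \<subset> D \<and> D2 \<subset> D \<and> is_direct_sum D D1 D2)"

definition ribbon :: "(nat \<times> nat) set \<Rightarrow> bool" where
  "ribbon R \<longleftrightarrow>
     skew_diagram R \<and> R \<noteq> {} \<and> connected_diagram R \<and>
     \<not> (\<exists>i j. {(i, j), (i, Suc j), (Suc i, j), (Suc i, Suc j)} \<subseteq> R)"

text \<open>
  The blocks of a decomposition of \<open>D\<close> are ribbons in the position they occupy in \<open>D\<close>; empty
  rows or columns of a block are not closed up. For a skew diagram the least number exists, as
  its cells are finitely many one-cell ribbons.
\<close>

definition ribbon_decomposition :: "(nat \<times> nat) set \<Rightarrow> (nat \<times> nat) set set \<Rightarrow> bool" where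
  "ribbon_decomposition D P \<longleftrightarrow> partition_on D P \<and> (\<forall>R\<in>P. ribbon R)"

definition frobenius_rank :: "(nat \<times> nat) set \<Rightarrow> nat" where
  "frobenius_rank D = (LEAST k. \<exists>P. ribbon_decomposition D P \<and> card P = k)"

end

theory Submission
  imports Defs "Jordan_Normal_Form.Determinant"
    "HOL-Computational_Algebra.Fundamental_Theorem_Algebra"
begin

text \<open>
  Let \<open>d e\<close> be the number of cells of \<open>D\<close> on the diagonal \<open>i - j = e\<close>. A ribbon meets the
  diagonals of an interval once each, so a decomposition needs at least as many ribbons as the total
  descent of \<open>d\<close>, and peeling off southeast rims attains this number. If column \<open>j\<close> of \<open>D\<close>
  consists of the rows \<open>b j \<le> i < a j\<close>, the total descent is \<open>card (A - B)\<close>, where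
  \<open>A\<close> and \<open>B\<close> are the sets of all \<open>\<alpha> j = a j - j\<close> and all \<open>\<beta> j = b j - j\<close>.

  On the other side, \<open>s\<^sub>D = det (e (\<alpha> i - \<beta> j))\<close> by the dual Jacobi-Trudi formula, proved by
  induction on the number of variables. By the fundamental theorem of algebra the elementary symmetric
  polynomials can be given arbitrary complex values; we choose \<open>e k = s ^ w k\<close> with \<open>w 0 = 0\<close> and
  \<open>w k = m + k\<^sup>2\<close> for a large \<open>m\<close>. Then \<open>s\<^sub>D\<close> becomes a polynomial in \<open>s\<close>. Its lowest term comes
  from a single permutation, which matches the elements of \<open>A \<inter> B\<close> with themselves and is increasing
  elsewhere, and its exponent divided by \<open>m\<close> is \<open>card (A - B)\<close>.
\<close>

section \<open>Skew diagrams as interval-closed sets\<close>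

text \<open>Order convexity for the componentwise order on cells. Together with finiteness it
  characterises skew diagrams, so ribbons and rims can be tested without exhibiting two
  partitions.\<close>

definition interval_closed :: "(nat \<times> nat) set \<Rightarrow> bool" where
  "interval_closed D \<longleftrightarrow>
     (\<forall>i j i' j' k l. (i, j) \<in> D \<longrightarrow> (i', j') \<in> D \<longrightarrow> i \<le> k \<longrightarrow> k \<le> i' \<longrightarrow> j \<le> l \<longrightarrow> l \<le> j' \<longrightarrow> (k, l) \<in> D)"

lemma interval_closedD:
  "\<lbrakk>interval_closed D; (i, j) \<in> D; (i', j') \<in> D; i \<le> k; k \<le> i'; j \<le> l; l \<le> j'\<rbrakk> \<Longrightarrow> (k, l) \<in> D"
  unfolding interval_closed_def by blast

lemma down_closed_eq_lessThan:
  fixes S :: "nat set"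
  assumes "finite S" "\<And>x y. x \<in> S \<Longrightarrow> y \<le> x \<Longrightarrow> y \<in> S"
  shows "S = {..<card S}"
proof (cases "S = {}")
  case False
  have "S = {..Max S}"
    using assms(2)[OF Max_in[OF assms(1) False]] Max_ge[OF assms(1)] by auto
  then show ?thesis by (metis card_atMost lessThan_Suc_atMost)
qed simp

lemma down_closed_eq_partition:
  fixes S :: "(nat \<times> nat) set"
  assumes fin: "finite S"
    and down: "\<And>i j i' j'. (i, j) \<in> S \<Longrightarrow> i' \<le> i \<Longrightarrow> j' \<le> j \<Longrightarrow> (i', j') \<in> S"
  obtains p where "is_partition p" "S = {(i, j). j < p i}"
proof -
  define p where "p i = card {j. (i, j) \<in> S}" for i
  have finr: "finite {j. (i, j) \<in> S}" for i
    by (rule finite_subset[of _ "snd ` S"]) (use fin in force)+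
  have eq: "{j. (i, j) \<in> S} = {..<p i}" for i
    unfolding p_def by (rule down_closed_eq_lessThan) (use finr down in auto)
  have "antimono p"
    by (rule antimonoI) (auto simp: p_def intro!: card_mono finr intro: down)
  moreover have "{i. p i \<noteq> 0} \<subseteq> fst ` S"
    using eq by force
  then have "finite {i. p i \<noteq> 0}"
    using fin finite_subset by blast
  ultimately show ?thesis
    using that[of p] eq unfolding is_partition_def by blast
qed

text \<open>For the converse, the order ideal \<open>I\<close> generated by \<open>D\<close> is the
  outer partition. By convexity of \<open>D\<close>, \<open>I - D\<close> is again an order ideal,
  and this is the inner partition.\<close>

lemma skew_diagram_iff: "skew_diagram D \<longleftrightarrow> finite D \<and> interval_closed D"
proof
  assume "skew_diagram D"
  then obtain l m where l: "is_partition l" and m: "is_partition m" and D: "D = skew_cells l m"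
    unfolding skew_diagram_def by blast
  have al: "antimono l" and am: "antimono m" and fl: "finite {i. l i \<noteq> 0}"
    using l m unfolding is_partition_def by auto
  have "D \<subseteq> {i. l i \<noteq> 0} \<times> {..<l 0}"
    unfolding D skew_cells_def using antimonoD[OF al le0] by (auto intro: less_le_trans)
  then have "finite D" using fl finite_subset by blast
  moreover have "interval_closed D"
    unfolding interval_closed_def
  proof (intro allI impI)
    fix i j i' j' k n
    assume "(i, j) \<in> D" "(i', j') \<in> D" "i \<le> k" "k \<le> i'" "j \<le> n" "n \<le> j'"
    then show "(k, n) \<in> D"
      using antimonoD[OF am, of i k] antimonoD[OF al, of k i'] unfolding D skew_cells_def by auto
  qed
  ultimately show "finite D \<and> interval_closed D" by simp
next
  assume D: "finite D \<and> interval_closed D"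
  define I where "I = {(i, j). \<exists>i' j'. (i', j') \<in> D \<and> i \<le> i' \<and> j \<le> j'}"
  have "I \<subseteq> (\<Union>(i', j')\<in>D. {..i'} \<times> {..j'})"
    unfolding I_def by fastforce
  then have finI: "finite I"
    by (rule finite_subset) (use D in auto)
  obtain l where l: "is_partition l" "I = {(i, j). j < l i}"
  proof (rule down_closed_eq_partition[OF finI])
    show "(i', j') \<in> I" if "(i, j) \<in> I" "i' \<le> i" "j' \<le> j" for i j i' j'
      using that unfolding I_def by simp (meson order_trans)
  qed
  have finI': "finite (I - D)" using finI by simp
  have "(i', j') \<in> I - D" if ij: "(i, j) \<in> I - D" and le: "i' \<le> i" "j' \<le> j" for i j i' j'
  proof -
    obtain k1 k2 where k: "(k1, k2) \<in> D" "i \<le> k1" "j \<le> k2" using ij unfolding I_def by auto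
    then have "(i', j') \<in> I" unfolding I_def using le by simp (meson order_trans)
    moreover have "(i', j') \<notin> D"
      using interval_closedD[of D i' j' k1 k2 i j] D k le ij by auto
    ultimately show ?thesis by simp
  qed
  then obtain m where m: "is_partition m" "I - D = {(i, j). j < m i}"
    using down_closed_eq_partition[OF finI'] by metis
  have "m \<le> l"
  proof (rule le_funI, rule ccontr)
    fix i assume "\<not> m i \<le> l i"
    then have "(i, l i) \<in> I - D" using m by auto
    then show False using l by auto
  qed
  moreover have "D \<subseteq> I" unfolding I_def by fastforce
  then have "c \<in> D \<longleftrightarrow> c \<in> I \<and> \<not> c \<in> I - D" for c by blast
  then have "D = skew_cells l m"
    unfolding skew_cells_def m(2) unfolding l(2) by auto
  ultimately show "skew_diagram D"
    unfolding skew_diagram_def using l m by blast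
qed

text \<open>Columns rather than rows, because the dual Jacobi-Trudi determinant is indexed by
  columns.\<close>

definition columns_diagram :: "nat \<Rightarrow> (nat \<Rightarrow> nat) \<Rightarrow> (nat \<Rightarrow> nat) \<Rightarrow> (nat \<times> nat) set" where
  "columns_diagram n a b = {(i, j). j < n \<and> b j \<le> i \<and> i < a j}"

lemma skew_diagram_columns:
  assumes "skew_diagram D"
  obtains n a b where "antimono a" "antimono b" "b \<le> a" "D = columns_diagram n a b"
proof -
  obtain l m where l: "is_partition l" and m: "is_partition m" and le: "m \<le> l"
    and D: "D = skew_cells l m"
    using assms unfolding skew_diagram_def by blast
  \<comment> \<open>Conjugate partition: the length of column \<open>j\<close>.\<close>
  define conj where "conj p j = card {i. j < p i}" for p :: "nat \<Rightarrow> nat" and j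
  have fin: "finite {i. j < p i}" if "is_partition p" for p :: "nat \<Rightarrow> nat" and j
    by (rule finite_subset[of _ "{i. p i \<noteq> 0}"]) (use that in \<open>auto simp: is_partition_def\<close>)
  have eq: "j < p i \<longleftrightarrow> i < conj p j" if p: "is_partition p" for p i j
  proof -
    have "{i. j < p i} = {..<conj p j}" unfolding conj_def
      by (rule down_closed_eq_lessThan[OF fin[OF p]])
        (use p in \<open>auto simp: is_partition_def dest!: antimonoD intro: less_le_trans\<close>)
    then show ?thesis by blast
  qed
  have anti: "antimono (conj p)" if p: "is_partition p" for p
    unfolding conj_def by (rule antimonoI, rule card_mono[OF fin[OF p]]) auto
  have "conj m \<le> conj l"
    unfolding conj_def
    by (rule le_funI, rule card_mono[OF fin[OF l]]) (use le in \<open>auto simp: le_fun_def intro: less_le_trans\<close>)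
  moreover have "j < l 0" if "j < l i" for i j
    using that l unfolding is_partition_def by (metis antimonoD le0 less_le_trans)
  then have "D = columns_diagram (l 0) (conj l) (conj m)"
    unfolding D skew_cells_def columns_diagram_def using eq[OF l] eq[OF m] by (auto simp: not_less[symmetric])
  ultimately show ?thesis using that anti l m by blast
qed

section \<open>Frobenius rank and diagonal lengths\<close>

text \<open>Row minus column, the negative of the usual content, so that it is on the same scale as
  the shifted column ends \<open>a j - j\<close>.\<close>

definition cell_content :: "nat \<times> nat \<Rightarrow> int" where
  "cell_content c = int (fst c) - int (snd c)"

lemma cell_content_Pair [simp]: "cell_content (i, j) = int i - int j"
  by (simp add: cell_content_def)

definition diag_card :: "(nat \<times> nat) set \<Rightarrow> int \<Rightarrow> nat" where
  "diag_card D e = card {c \<in> D. cell_content c = e}"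

text \<open>Subtraction on \<open>nat\<close> truncates, so ascents count as zero. A descent starts
  on a nonempty diagonal, hence the occupied contents suffice.\<close>

definition descent_rank :: "(nat \<times> nat) set \<Rightarrow> nat" where
  "descent_rank D = (\<Sum>e\<in>cell_content ` D. diag_card D e - diag_card D (e + 1))"

lemma diag_card_eq_0: "e \<notin> cell_content ` D \<Longrightarrow> diag_card D e = 0"
  unfolding diag_card_def by (metis (mono_tags, lifting) card.empty empty_Collect_eq image_eqI)

lemma diag_card_gt_0: "finite D \<Longrightarrow> e \<in> cell_content ` D \<Longrightarrow> 0 < diag_card D e"
  unfolding diag_card_def by (fastforce simp: card_gt_0_iff)

lemma descent_rank_superset:
  assumes "finite X" "cell_content ` D \<subseteq> X"
  shows "descent_rank D = (\<Sum>e\<in>X. diag_card D e - diag_card D (e + 1))"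
  unfolding descent_rank_def by (rule sum.mono_neutral_left) (use assms diag_card_eq_0 in auto)

text \<open>A monotone lattice path joins two comparable cells and meets every content in between.\<close>
lemma comparable_contents:
  assumes conv: "interval_closed D" and x: "(i, j) \<in> D" and z: "(i', j') \<in> D"
    and le: "i \<le> i'" "j \<le> j'"
    and e: "min (cell_content (i, j)) (cell_content (i', j')) \<le> e" "e \<le> max (cell_content (i, j)) (cell_content (i', j'))"
  shows "\<exists>c\<in>D. cell_content c = e"
proof -
  consider "int i - int j' \<le> e" "e \<le> int i' - int j'" | "int i - int j' \<le> e" "e \<le> int i - int j"
    using e le by (auto simp: min_def max_def split: if_splits)
  then show ?thesis
  proof cases
    case 1
    then have "(nat (e + int j'), j') \<in> D"
      by (intro interval_closedD[OF conv x z]) (use le in auto)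
    then show ?thesis using 1 by force
  next
    case 2
    then have "(i, nat (int i - e)) \<in> D"
      by (intro interval_closedD[OF conv x z]) (use le in auto)
    then show ?thesis using 2 by force
  qed
qed

text \<open>Two cells on one diagonal span a rectangle inside \<open>R\<close> by convexity, and its
  upper left corner is a forbidden block.\<close>

lemma ribbon_diag_card_le_1:
  assumes "ribbon R"
  shows "diag_card R e \<le> 1"
proof -
  have conv: "interval_closed R" and sq: "\<not> (\<exists>i j. {(i, j), (i, Suc j), (Suc i, j), (Suc i, Suc j)} \<subseteq> R)"
    using assms unfolding ribbon_def skew_diagram_iff by auto
  have False if x: "(i, j) \<in> R" and z: "(i', j') \<in> R" and "int i - int j = int i' - int j'" "i < i'"
    for i j i' j'
  proof -
    have "{(i, j), (i, Suc j), (Suc i, j), (Suc i, Suc j)} \<subseteq> R"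
      using interval_closedD[OF conv x z] that by auto
    then show False using sq by blast
  qed
  note lt = this
  have "c = c'" if "c \<in> {c \<in> R. cell_content c = e}" "c' \<in> {c \<in> R. cell_content c = e}" for c c'
  proof -
    obtain i j i' j' where c: "c = (i, j)" "c' = (i', j')" by (cases c; cases c') blast
    have "\<not> i < i'" "\<not> i' < i" using lt[of i j i' j'] lt[of i' j' i j] that c by auto
    then show ?thesis using that c by auto
  qed
  then show ?thesis unfolding diag_card_def
    by (metis (no_types, lifting) card.infinite card_le_Suc0_iff_eq One_nat_def zero_le)
qed

text \<open>A missing content \<open>e\<close> splits \<open>R\<close> into the cells of larger and
  of smaller content. Comparable cells are joined by a path through all contents between theirs, so
  cells from different sides are incomparable and \<open>R\<close> would be a direct sum.\<close>

lemma ribbon_content_interval: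
  assumes R: "ribbon R" and e: "e1 \<in> cell_content ` R" "e2 \<in> cell_content ` R" "e1 \<le> e" "e \<le> e2"
  shows "e \<in> cell_content ` R"
proof (rule ccontr)
  assume ne: "e \<notin> cell_content ` R"
  have fin: "finite R" and conv: "interval_closed R" and con: "connected_diagram R"
    using R unfolding ribbon_def skew_diagram_iff by auto
  define D1 where "D1 = {c \<in> R. e < cell_content c}"
  define D2 where "D2 = {c \<in> R. cell_content c < e}"
  have R12: "R = D1 \<union> D2" unfolding D1_def D2_def using ne by force
  have sep: "i2 < i1 \<and> j1 < j2" if c: "(i1, j1) \<in> D1" "(i2, j2) \<in> D2" for i1 j1 i2 j2
  proof -
    have r: "(i1, j1) \<in> R" "(i2, j2) \<in> R" and lt: "int i2 - int j2 < e" "e < int i1 - int j1"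
      using c unfolding D1_def D2_def by auto
    have "\<not> (i1 \<le> i2 \<and> j1 \<le> j2)"
      using comparable_contents[OF conv r(1) r(2), of e] lt ne by force
    moreover have "\<not> (i2 \<le> i1 \<and> j2 \<le> j1)"
      using comparable_contents[OF conv r(2) r(1), of e] lt ne by force
    ultimately show ?thesis using lt by linarith
  qed
  have ne1: "D1 \<noteq> {}" and ne2: "D2 \<noteq> {}"
    using e ne unfolding D1_def D2_def by (auto simp: order_le_less)
  have disj: "D1 \<inter> D2 = {}" unfolding D1_def D2_def by auto
  have "interval_closed D1" "interval_closed D2"
  proof -
    have "(k, l) \<in> D1" if "(i, j) \<in> D1" "(i', j') \<in> D1" "i \<le> k" "k \<le> i'" "j \<le> l" "l \<le> j'" for i j i' j' k l
    proof -
      have "(k, l) \<in> R" using interval_closedD[OF conv _ _ that(3-)] that(1,2) R12 by blast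
      moreover have "(k, l) \<notin> D2" using sep[of i' j' k l] sep[OF that(1), of k l] that by auto
      ultimately show ?thesis using R12 by blast
    qed
    then show "interval_closed D1" unfolding interval_closed_def by blast
    have "(k, l) \<in> D2" if "(i, j) \<in> D2" "(i', j') \<in> D2" "i \<le> k" "k \<le> i'" "j \<le> l" "l \<le> j'" for i j i' j' k l
    proof -
      have "(k, l) \<in> R" using interval_closedD[OF conv _ _ that(3-)] that(1,2) R12 by blast
      moreover have "(k, l) \<notin> D1" using sep[of k l i j] sep[OF _ that(2), of k l] that by auto
      ultimately show ?thesis using R12 by blast
    qed
    then show "interval_closed D2" unfolding interval_closed_def by blast
  qed
  moreover have "finite D1" "finite D2" using fin R12 by auto
  moreover have "is_direct_sum R D1 D2"
    unfolding is_direct_sum_def using R12 sep by blast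
  moreover have "D1 \<subset> R" "D2 \<subset> R" using R12 ne1 ne2 disj by blast+
  ultimately show False
    using con unfolding connected_diagram_def skew_diagram_iff by blast
qed

text \<open>The contents form an interval with one cell each, so the only possible descent is at the
  largest content.\<close>

lemma descent_rank_ribbon_le_1:
  assumes R: "ribbon R"
  shows "descent_rank R \<le> 1"
proof -
  have fin: "finite R" using R unfolding ribbon_def skew_diagram_iff by auto
  define X where "X = {e \<in> cell_content ` R. e + 1 \<notin> cell_content ` R}"
  have finX: "finite X" unfolding X_def using fin by simp
  have uniq: "x = y" if "x \<in> X" "y \<in> X" for x y
  proof (rule ccontr)
    assume "x \<noteq> y"
    then have "x + 1 \<le> y \<or> y + 1 \<le> x" by linarith
    then show False
      using ribbon_content_interval[OF R, of x y "x + 1"] ribbon_content_interval[OF R, of y x "y + 1"]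
        that unfolding X_def by fastforce
  qed
  have card: "card X \<le> 1"
    using card_le_Suc0_iff_eq[OF finX] uniq by simp
  have "descent_rank R \<le> (\<Sum>e\<in>cell_content ` R. if e \<in> X then 1 else 0)"
    unfolding descent_rank_def
  proof (rule sum_mono)
    fix e assume e: "e \<in> cell_content ` R"
    show "diag_card R e - diag_card R (e + 1) \<le> (if e \<in> X then 1 else 0)"
    proof (cases "e + 1 \<in> cell_content ` R")
      case True
      then show ?thesis
        using ribbon_diag_card_le_1[OF R, of e] diag_card_gt_0[OF fin True] by simp
    next
      case False
      then have "e \<in> X" using e unfolding X_def by blast
      then show ?thesis using ribbon_diag_card_le_1[OF R, of e] by simp
    qed
  qed
  also have "\<dots> = card X"
  proof -
    have "cell_content ` R \<inter> {e. e \<in> X} = X" unfolding X_def by blast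
    then show ?thesis using fin by (simp add: sum.If_cases)
  qed
  finally show ?thesis using card by simp
qed

text \<open>Diagonal lengths add up over the blocks, truncated differences are subadditive, and each
  block contributes at most one.\<close>

lemma descent_rank_le_card_ribbon_decomposition:
  assumes fin: "finite D" and P: "ribbon_decomposition D P"
  shows "descent_rank D \<le> card P"
proof -
  have part: "partition_on D P" and rib: "\<And>R. R \<in> P \<Longrightarrow> ribbon R"
    using P unfolding ribbon_decomposition_def by auto
  have finP: "finite P" using finite_elements[OF fin part] .
  have finR: "finite R" if "R \<in> P" for R
    using that fin partition_onD1[OF part] by (auto intro: finite_subset)
  have diag: "diag_card D e = (\<Sum>R\<in>P. diag_card R e)" for e
  proof -
    have "{c \<in> D. cell_content c = e} = (\<Union>R\<in>P. {c \<in> R. cell_content c = e})"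
      using partition_onD1[OF part] by auto
    moreover have "card (\<Union>R\<in>P. {c \<in> R. cell_content c = e}) = (\<Sum>R\<in>P. card {c \<in> R. cell_content c = e})"
      by (rule card_UN_disjoint[OF finP])
        (use finR partition_onD2[OF part] in \<open>auto simp: pairwise_def disjnt_def\<close>)
    ultimately show ?thesis unfolding diag_card_def by simp
  qed
  have sub: "(\<Sum>R\<in>P. f R) - (\<Sum>R\<in>P. g R) \<le> (\<Sum>R\<in>P. f R - g R)" for f g :: "(nat \<times> nat) set \<Rightarrow> nat"
  proof -
    have "(\<Sum>R\<in>P. f R) \<le> (\<Sum>R\<in>P. (f R - g R) + g R)" by (rule sum_mono) simp
    then show ?thesis by (simp add: sum.distrib)
  qed
  have "descent_rank D \<le> (\<Sum>e\<in>cell_content ` D. \<Sum>R\<in>P. diag_card R e - diag_card R (e + 1))"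
    unfolding descent_rank_def diag by (rule sum_mono) (rule sub)
  also have "\<dots> = (\<Sum>R\<in>P. descent_rank R)"
  proof (subst sum.swap, rule sum.cong[OF refl])
    fix R assume "R \<in> P"
    then have "cell_content ` R \<subseteq> cell_content ` D" using partition_onD1[OF part] by auto
    then show "(\<Sum>e\<in>cell_content ` D. diag_card R e - diag_card R (e + 1)) = descent_rank R"
      using descent_rank_superset[of "cell_content ` D" R] fin by simp
  qed
  also have "\<dots> \<le> (\<Sum>R\<in>P. 1)"
    by (rule sum_mono) (use rib descent_rank_ribbon_le_1 in blast)
  finally show ?thesis by simp
qed

text \<open>
  The southeast rim of the component of \<open>D\<close> containing the largest cell_content: it meets each diagonal
  of that component exactly once, so its removal lowers exactly one descent of \<open>diag_card D\<close>.
\<close>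
lemma remove_rim_ribbon:
  assumes fin: "finite D" and conv: "interval_closed D" and ne: "D \<noteq> {}"
  obtains R where "ribbon R" "R \<subseteq> D" "interval_closed (D - R)"
    "Suc (descent_rank (D - R)) = descent_rank D"
proof -
  define q where "q = Max (cell_content ` D)"
  have q: "q \<in> cell_content ` D" and qmax: "\<And>e. e \<in> cell_content ` D \<Longrightarrow> e \<le> q"
    unfolding q_def using fin ne by auto
  \<comment> \<open>The contents of the component: the maximal run of consecutive occupied contents
    that ends at \<open>q\<close>.\<close>
  define X where "X = {e. e \<le> q \<and> {e..q} \<subseteq> cell_content ` D}"
  have qX: "q \<in> X" unfolding X_def using q by simp
  have XD: "X \<subseteq> cell_content ` D" unfolding X_def by auto
  have Xup: "e' \<in> X" if "e \<in> X" "e \<le> e'" "e' \<le> q" for e e'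
    using that unfolding X_def by (auto simp: subset_iff)
  have Xstep: "e \<in> X" if "e + 1 \<in> X" "e \<in> cell_content ` D" for e
  proof -
    have "{e..q} = insert e {e + 1..q}" using that unfolding X_def by auto
    then show ?thesis using that unfolding X_def by auto
  qed
  have Xdown: "e \<in> X" if "e' \<in> X" "\<And>d. e \<le> d \<Longrightarrow> d \<le> e' \<Longrightarrow> d \<in> cell_content ` D" "e \<le> q" for e e'
  proof (cases "e \<le> e'")
    case True
    then have "{e..q} = {e..e'} \<union> {e'..q}" "e \<le> q" using that unfolding X_def by auto
    then show ?thesis using that unfolding X_def by auto
  next
    case False
    then show ?thesis using that unfolding X_def by auto
  qed
  \<comment> \<open>Comparable cells belong to the same component, since every content between
    theirs occurs in \<open>D\<close>.\<close>
  have comp: "cell_content (i, j) \<in> X \<longleftrightarrow> cell_content (i', j') \<in> X"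
    if "(i, j) \<in> D" "(i', j') \<in> D" "i \<le> i'" "j \<le> j'" for i j i' j'
  proof -
    have path: "d \<in> cell_content ` D" if "min (cell_content (i, j)) (cell_content (i', j')) \<le> d" 
      "d \<le> max (cell_content (i, j)) (cell_content (i', j'))" for d
      using comparable_contents[OF conv \<open>(i, j) \<in> D\<close> \<open>(i', j') \<in> D\<close> \<open>i \<le> i'\<close> \<open>j \<le> j'\<close> that] by blast
    have qq: "cell_content (i, j) \<le> q" "cell_content (i', j') \<le> q" using qmax that by blast+
    show ?thesis
    proof
      assume X: "cell_content (i, j) \<in> X"
      show "cell_content (i', j') \<in> X"
      proof (cases "cell_content (i, j) \<le> cell_content (i', j')")
        case True
        then show ?thesis using Xup[OF X _ qq(2)] by blast
      next
        case False
        then show ?thesis using path by (intro Xdown[OF X _ qq(2)]) auto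
      qed
    next
      assume X: "cell_content (i', j') \<in> X"
      show "cell_content (i, j) \<in> X"
      proof (cases "cell_content (i', j') \<le> cell_content (i, j)")
        case True
        then show ?thesis using Xup[OF X _ qq(1)] by blast
      next
        case False
        then show ?thesis using path by (intro Xdown[OF X _ qq(1)]) auto
      qed
    qed
  qed
  \<comment> \<open>The last cell of each diagonal of the component.\<close>
  define R where "R = {(i, j) \<in> D. (Suc i, Suc j) \<notin> D \<and> cell_content (i, j) \<in> X}"
  have RD: "R \<subseteq> D" unfolding R_def by auto
  have uniq: "c = c'" if c: "c \<in> R" "c' \<in> R" "cell_content c = cell_content c'" for c c'
  proof -
    have *: False if "(i, j) \<in> R" "(i', j') \<in> R" "int i - int j = int i' - int j'" "i < i'" for i j i' j'
      using interval_closedD[OF conv, of i j i' j' "Suc i" "Suc j"] that unfolding R_def by auto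
    obtain i j i' j' where ij: "c = (i, j)" "c' = (i', j')" by (cases c; cases c') blast
    have "\<not> i < i'" "\<not> i' < i" using *[of i j i' j'] *[of i' j' i j] c ij by auto
    then show ?thesis using c ij by auto
  qed
  have ex: "\<exists>c\<in>R. cell_content c = e" if e: "e \<in> X" for e
  proof -
    define S where "S = {i. \<exists>j. (i, j) \<in> D \<and> cell_content (i, j) = e}"
    have "S \<subseteq> fst ` D" unfolding S_def by force
    then have finS: "finite S" using fin finite_subset by blast
    have "S \<noteq> {}" using e XD unfolding S_def by fastforce
    then have "Max S \<in> S" using finS by simp
    then obtain j where j: "(Max S, j) \<in> D" "cell_content (Max S, j) = e" unfolding S_def by blast
    have "(Suc (Max S), Suc j) \<notin> D"
    proof
      assume "(Suc (Max S), Suc j) \<in> D"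
      moreover have "cell_content (Suc (Max S), Suc j) = e" using j(2) by simp
      ultimately have "Suc (Max S) \<in> S" using S_def by blast
      then show False using Max_ge[OF finS] by fastforce
    qed
    then show ?thesis using j e unfolding R_def by blast
  qed
  have Rconv: "interval_closed R"
    unfolding interval_closed_def
  proof (intro allI impI)
    fix i j i' j' k l
    assume c: "(i, j) \<in> R" "(i', j') \<in> R" and le: "i \<le> k" "k \<le> i'" "j \<le> l" "l \<le> j'"
    have D: "(i, j) \<in> D" "(i', j') \<in> D" using c RD by auto
    have kl: "(k, l) \<in> D" using interval_closedD[OF conv D le] .
    have "(Suc k, Suc l) \<notin> D"
      using interval_closedD[OF conv D(1), of "Suc k" "Suc l" "Suc i" "Suc j"] le c unfolding R_def by auto
    then show "(k, l) \<in> R" using kl comp[OF D(1) kl] le c unfolding R_def by auto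
  qed
  have conn: "connected_diagram R"
    unfolding connected_diagram_def
  proof (intro notI, elim exE conjE)
    fix D1 D2 assume sub: "D1 \<subset> R" "D2 \<subset> R" and ds: "is_direct_sum R D1 D2"
    have un: "R = D1 \<union> D2" and sep: "\<And>i1 j1 i2 j2. (i1, j1) \<in> D1 \<Longrightarrow> (i2, j2) \<in> D2 \<Longrightarrow> i2 < i1 \<and> j1 < j2"
      using ds unfolding is_direct_sum_def by blast+
    have nonempty: "D1 \<noteq> {}" "D2 \<noteq> {}" using sub un by auto
    have finD: "finite D2" using un RD fin by (meson finite_subset le_sup_iff)
    \<comment> \<open>The rim has a cell of content \<open>m + 1\<close>, which must lie in
      \<open>D1\<close>. But a cell strictly south and strictly west of the cell of content
      \<open>m\<close> in \<open>D2\<close> has content at least \<open>m + 2\<close>.\<close>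
    define m where "m = Max (cell_content ` D2)"
    have m: "m \<in> cell_content ` D2" "\<And>e. e \<in> cell_content ` D2 \<Longrightarrow> e \<le> m"
      unfolding m_def using finD nonempty by auto
    obtain i2 j2 where c2: "(i2, j2) \<in> D2" "cell_content (i2, j2) = m" using m by force
    obtain i1 j1 where c1: "(i1, j1) \<in> D1" using nonempty by auto
    have "m < cell_content (i1, j1)" using sep[OF c1 c2(1)] c2 by auto
    moreover have "cell_content (i1, j1) \<le> q" using c1 un RD qmax by blast
    moreover have "m \<in> X" using c2 un unfolding R_def by auto
    ultimately have "m + 1 \<in> X" using Xup by force
    then obtain c where c: "c \<in> R" "cell_content c = m + 1" using ex by blast
    then have "c \<in> D1" using un m(2)[of "m + 1"] by force
    then show False using sep[of "fst c" "snd c" i2 j2] c2 c by (cases c) auto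
  qed
  have Rne: "R \<noteq> {}" using ex[OF qX] by auto
  have "ribbon R"
    unfolding ribbon_def skew_diagram_iff
    using Rconv conn Rne finite_subset[OF RD fin] by (auto simp: R_def)
  moreover have "interval_closed (D - R)"
    unfolding interval_closed_def
  proof (intro allI impI)
    fix i j i' j' k l
    assume c: "(i, j) \<in> D - R" "(i', j') \<in> D - R" and le: "i \<le> k" "k \<le> i'" "j \<le> l" "l \<le> j'"
    have kl: "(k, l) \<in> D" using interval_closedD[OF conv _ _ le] c by auto
    moreover have "(k, l) \<notin> R"
    proof
      assume r: "(k, l) \<in> R"
      \<comment> \<open>The cell \<open>(i', j')\<close> lies in the same component as
        \<open>(k, l)\<close> but not on the rim, so its diagonal successor is in \<open>D\<close>;
        convexity carries this back to \<open>(k, l)\<close>.\<close>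
      then have "(Suc i', Suc j') \<in> D"
        using comp[OF kl _ le(2,4)] c unfolding R_def by auto
      then have "(Suc k, Suc l) \<in> D"
        using interval_closedD[OF conv kl] le by auto
      then show False using r unfolding R_def by auto
    qed
    ultimately show "(k, l) \<in> D - R" by simp
  qed
  moreover have "Suc (descent_rank (D - R)) = descent_rank D"
  proof -
    have dR: "diag_card R e = (if e \<in> X then 1 else 0)" for e
    proof (cases "e \<in> X")
      case True
      then obtain c where "c \<in> R" "cell_content c = e" using ex by blast
      then have "{c \<in> R. cell_content c = e} = {c}" using uniq by blast
      then show ?thesis using True unfolding diag_card_def by simp
    next
      case False
      then have "e \<notin> cell_content ` R" unfolding R_def by auto
      then show ?thesis using False diag_card_eq_0 by simp
    qed
    have dD: "diag_card D e = diag_card (D - R) e + diag_card R e" for e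
    proof -
      have "{c \<in> D. cell_content c = e} = {c \<in> D - R. cell_content c = e} \<union> {c \<in> R. cell_content c = e}"
        using RD by auto
      then show ?thesis unfolding diag_card_def
        using fin RD by (simp add: card_Un_disjoint disjoint_iff finite_subset)
    qed
    have zero: "diag_card (D - R) e = 0" if "e \<notin> cell_content ` D" for e
      using diag_card_eq_0[OF that] dD[of e] by simp
    \<comment> \<open>Removing one cell from each diagonal in \<open>X\<close> alters a difference
      only at the two ends of \<open>X\<close>. At the upper end \<open>q\<close> a descent drops by
      one; just below the lower end the diagonal is empty, and truncation makes both differences
      zero.\<close>
    have step: "diag_card D e - diag_card D (e + 1)
        = (diag_card (D - R) e - diag_card (D - R) (e + 1)) + (if e = q then 1 else 0)" for e
    proof (cases "e = q")
      case True
      have "q + 1 \<notin> cell_content ` D" using qmax[of "q + 1"] by auto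
      moreover from this have "q + 1 \<notin> X" using XD by auto
      ultimately show ?thesis using True dD dR zero[of "q + 1"] qX by simp
    next
      case False
      show ?thesis
      proof (cases "e \<in> X \<longleftrightarrow> e + 1 \<in> X")
        case True
        then show ?thesis using \<open>e \<noteq> q\<close> dD dR by simp
      next
        case neq: False
        have "e \<notin> X"
        proof
          assume "e \<in> X"
          moreover from this have "e + 1 \<le> q" using False unfolding X_def by auto
          ultimately show False using neq Xup[of e "e + 1"] by auto
        qed
        then have "e \<notin> cell_content ` D" using neq Xstep by blast
        then show ?thesis using \<open>e \<noteq> q\<close> zero diag_card_eq_0 by simp
      qed
    qed
    have "descent_rank D = (\<Sum>e\<in>cell_content ` D. (diag_card (D - R) e - diag_card (D - R) (e + 1)) + (if e = q then 1 else 0))"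
      unfolding descent_rank_def by (rule sum.cong[OF refl step])
    also have "\<dots> = descent_rank (D - R) + 1"
      using descent_rank_superset[of "cell_content ` D" "D - R"] fin q by (simp add: sum.distrib image_mono)
    finally show ?thesis by simp
  qed
  ultimately show ?thesis using that RD by blast
qed

section \<open>Optimal decompositions and ribbons as the diagrams of rank one\<close>

lemma ribbon_decomposition_exists:
  assumes "finite D" "interval_closed D"
  shows "\<exists>P. ribbon_decomposition D P \<and> card P = descent_rank D"
  using assms
proof (induction "card D" arbitrary: D rule: less_induct)
  case less
  show ?case
  proof (cases "D = {}")
    case True
    then show ?thesis
      by (intro exI[of _ "{}"]) (simp add: ribbon_decomposition_def partition_on_empty descent_rank_def)
  next
    case False
    obtain R where R: "ribbon R" "R \<subseteq> D" "interval_closed (D - R)"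
        "Suc (descent_rank (D - R)) = descent_rank D"
      using remove_rim_ribbon[OF less.prems False] .
    have Rne: "R \<noteq> {}" using R(1) unfolding ribbon_def by auto
    have "card (D - R) < card D"
      by (rule psubset_card_mono) (use less.prems R Rne in auto)
    then obtain P where P: "ribbon_decomposition (D - R) P" "card P = descent_rank (D - R)"
      using less.hyps[of "D - R"] less.prems R(3) by auto
    have part: "partition_on (D - R) P" using P unfolding ribbon_decomposition_def by auto
    have "R \<notin> P" using part Rne by (auto simp: partition_on_def)
    moreover have "finite P" using finite_elements[OF _ part] less.prems by auto
    ultimately have "card (insert R P) = descent_rank D" using P R by simp
    moreover have "partition_on D (insert R P)"
    proof (rule partition_onI)
      show "\<Union> (insert R P) = D" using part R(2) by (auto simp: partition_on_def)
      show "{} \<notin> insert R P" using part Rne by (auto simp: partition_on_def)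
      fix p r assume pr: "p \<in> insert R P" "r \<in> insert R P" "p \<noteq> r"
      have "disjnt R p'" if "p' \<in> P" for p'
        using that partition_onD1[OF part] by (auto simp: disjnt_def)
      then show "disjnt p r"
        using pr partition_onD2[OF part] by (auto simp: pairwise_def disjnt_sym)
    qed
    ultimately show ?thesis using P R unfolding ribbon_decomposition_def by blast
  qed
qed

lemma frobenius_rank_eq_descent_rank:
  assumes "skew_diagram D"
  shows "frobenius_rank D = descent_rank D"
  unfolding frobenius_rank_def
  by (rule Least_equality)
    (use assms ribbon_decomposition_exists descent_rank_le_card_ribbon_decomposition
      in \<open>auto simp: skew_diagram_iff\<close>)

lemma ribbon_iff_frobenius_rank_1:
  assumes D: "skew_diagram D"
  shows "ribbon D \<longleftrightarrow> frobenius_rank D = 1"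
proof
  assume R: "ribbon D"
  have "ribbon_decomposition D {D}"
    using R unfolding ribbon_decomposition_def ribbon_def by (auto intro: partition_onI)
  then have "descent_rank D \<le> 1"
    using descent_rank_le_card_ribbon_decomposition[of D "{D}"] D by (simp add: skew_diagram_iff)
  moreover have "descent_rank D \<noteq> 0"
    using remove_rim_ribbon[of D] R by (metis nat.distinct(1) ribbon_def skew_diagram_iff)
  ultimately show "frobenius_rank D = 1"
    using frobenius_rank_eq_descent_rank[OF D] by simp
next
  assume "frobenius_rank D = 1"
  then obtain P where P: "ribbon_decomposition D P" "card P = 1"
    using ribbon_decomposition_exists[of D] frobenius_rank_eq_descent_rank[OF D] D
    by (auto simp: skew_diagram_iff)
  then obtain R where "P = {R}" by (auto simp: card_1_singleton_iff)
  then show "ribbon D" using P unfolding ribbon_decomposition_def partition_on_def by auto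
qed

section \<open>Elementary symmetric polynomials\<close>

text \<open>The variables are \<open>x 1, \<dots>, x N\<close>; \<open>x 0\<close> is ignored, as entries of fillings are positive.\<close>
primrec esym :: "(nat \<Rightarrow> 'a::comm_ring_1) \<Rightarrow> nat \<Rightarrow> int \<Rightarrow> 'a" where
  "esym x 0 k = (if k = 0 then 1 else 0)"
| "esym x (Suc N) k = esym x N k + x (Suc N) * esym x N (k - 1)"

lemma esym_neg: "k < 0 \<Longrightarrow> esym x N k = 0"
  by (induction N arbitrary: k) auto

lemma esym_cong: "(\<And>i. 1 \<le> i \<Longrightarrow> i \<le> N \<Longrightarrow> x i = y i) \<Longrightarrow> esym x N k = esym y N k"
  by (induction N arbitrary: k) auto

text \<open>The elementary symmetric polynomials are the coefficients of the product of the factors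
  \<open>1 + x i * t\<close>. So \<open>p\<close> is split into such factors over the complex
  numbers, with factor \<open>1\<close> once the degree is used up.\<close>

lemma esym_surj:
  fixes p :: "complex poly"
  assumes "coeff p 0 = 1" "degree p \<le> N"
  shows "\<exists>x. \<forall>k. esym x N (int k) = coeff p k"
  using assms
proof (induction N arbitrary: p)
  case 0
  then have "p = [:1:]" by (metis degree_eq_zeroE coeff_pCons_0 le_zero_eq)
  then show ?case by (auto simp: coeff_pCons split: nat.splits)
next
  case (Suc N)
  obtain u r where p: "p = [:1, u:] * r" and r: "coeff r 0 = 1" "degree r \<le> N"
  proof (cases "degree p = 0")
    case True
    then show ?thesis using that[of 0 p] Suc.prems by simp
  next
    case False
    then obtain z where z: "poly p z = 0"
      using fundamental_theorem_of_algebra[of p] by (auto simp: constant_degree)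
    have z0: "z \<noteq> 0" using z Suc.prems(1) by (auto simp: poly_0_coeff_0)
    obtain r where r: "p = [:- z, 1:] * r" using z poly_eq_0_iff_dvd by blast
    have "r \<noteq> 0" using Suc.prems(1) r by auto
    then have "degree p = Suc (degree r)" unfolding r by (subst degree_mult_eq) auto
    then have "degree r \<le> N" using Suc.prems by simp
    moreover have "coeff p 0 = - z * coeff r 0" unfolding r by simp
    \<comment> \<open>Normalises the linear factor to constant term \<open>1\<close>; the scalar
      \<open>- z\<close> moves into the cofactor.\<close>
    moreover have "[:- z, 1:] = smult (- z) [:1, - (1 / z):]" using z0 by simp
    then have "[:- z, 1:] * r = [:1, - (1 / z):] * smult (- z) r"
      by (metis mult_smult_left mult_smult_right)
    ultimately show ?thesis
      using that[of "- (1 / z)" "smult (- z) r"] r Suc.prems z0 by simp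
  qed
  obtain x where x: "\<And>k. esym x N (int k) = coeff r k" using Suc.IH[OF r] by blast
  define y where "y = x(Suc N := u)"
  have y: "esym y N k = esym x N k" for k
    by (rule esym_cong) (simp add: y_def)
  have "esym y (Suc N) (int k) = coeff p k" for k
  proof (cases k)
    case 0
    then show ?thesis using x[of 0] by (simp add: y p esym_neg)
  next
    case (Suc k')
    have "y (Suc N) = u" unfolding y_def by simp
    then show ?thesis using Suc x[of k] x[of k'] by (simp add: y p)
  qed
  then show ?case by blast
qed

section \<open>The dual Jacobi-Trudi formula\<close>

definition bounded_fillings :: "(nat \<times> nat) set \<Rightarrow> nat \<Rightarrow> (nat \<times> nat \<Rightarrow> nat) set" where
  "bounded_fillings D N = {T \<in> column_strict_fillings D. T ` D \<subseteq> {..N}}"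

lemma finite_columns_diagram [simp]: "finite (columns_diagram n a b)"
  by (rule finite_subset[of _ "(\<Union>j<n. {..<a j} \<times> {j})"]) (auto simp: columns_diagram_def)

lemma bounded_fillings_subset: "bounded_fillings D N \<subseteq> D \<rightarrow>\<^sub>E {1..N}"
  unfolding bounded_fillings_def column_strict_fillings_def
  by (force simp: PiE_def Pi_def)

lemma finite_bounded_fillings: "finite D \<Longrightarrow> finite (bounded_fillings D N)"
  by (rule finite_subset[OF bounded_fillings_subset]) (simp add: finite_PiE)

text \<open>The column sets whose bottom cells can form the horizontal strip of largest entries.
  Among columns ending in the same row, weakly increasing rows force the set to be closed to the
  right.\<close>

definition removable :: "nat \<Rightarrow> (nat \<Rightarrow> nat) \<Rightarrow> (nat \<Rightarrow> nat) \<Rightarrow> nat set set" where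
  "removable n a b = {E. E \<subseteq> {..<n} \<and> (\<forall>j\<in>E. b j < a j) \<and>
     (\<forall>j k. j < k \<longrightarrow> k < n \<longrightarrow> a j = a k \<longrightarrow> j \<in> E \<longrightarrow> k \<in> E)}"

definition shorten :: "nat set \<Rightarrow> (nat \<Rightarrow> nat) \<Rightarrow> nat \<Rightarrow> nat" where
  "shorten E a j = (if j \<in> E then a j - 1 else a j)"

lemma bounded_fillingsI:
  assumes "T \<in> D \<rightarrow>\<^sub>E {1..N}"
    "\<And>i j j'. (i, j) \<in> D \<Longrightarrow> (i, j') \<in> D \<Longrightarrow> j < j' \<Longrightarrow> T (i, j) \<le> T (i, j')"
    "\<And>i i' j. (i, j) \<in> D \<Longrightarrow> (i', j) \<in> D \<Longrightarrow> i < i' \<Longrightarrow> T (i, j) < T (i', j)"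
  shows "T \<in> bounded_fillings D N"
  using assms unfolding bounded_fillings_def column_strict_fillings_def
  by (fastforce simp: PiE_def Pi_def)

lemma bounded_fillingsD:
  assumes "T \<in> bounded_fillings D N"
  shows "T \<in> D \<rightarrow>\<^sub>E {1..N}"
    "\<And>i j j'. (i, j) \<in> D \<Longrightarrow> (i, j') \<in> D \<Longrightarrow> j < j' \<Longrightarrow> T (i, j) \<le> T (i, j')"
    "\<And>i i' j. (i, j) \<in> D \<Longrightarrow> (i', j) \<in> D \<Longrightarrow> i < i' \<Longrightarrow> T (i, j) < T (i', j)"
  using assms bounded_fillings_subset[of D N]
  unfolding bounded_fillings_def column_strict_fillings_def by auto

text \<open>Strict columns allow \<open>Suc N\<close> only in bottom cells. Classifying fillings by
  the set \<open>E\<close> of columns where it occurs and deleting these cells leaves the fillings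
  of the shortened diagram with entries up to \<open>N\<close>.\<close>

lemma sum_bounded_fillings_Suc:
  fixes x :: "nat \<Rightarrow> 'a::comm_ring_1"
  assumes a: "antimono_on {..<n} a" and b: "antimono_on {..<n} b" and ba: "\<And>j. j < n \<Longrightarrow> b j \<le> a j"
  defines "Dg \<equiv> \<lambda>c. columns_diagram n c b"
  shows "(\<Sum>T\<in>bounded_fillings (Dg a) (Suc N). \<Prod>c\<in>Dg a. x (T c)) =
    (\<Sum>E\<in>removable n a b. x (Suc N) ^ card E *
       (\<Sum>T\<in>bounded_fillings (Dg (shorten E a)) N. \<Prod>c\<in>Dg (shorten E a). x (T c)))"
proof -
  let ?S = "\<lambda>E. Dg (shorten E a)"
  have finrem: "finite (removable n a b)"
    by (rule finite_subset[of _ "Pow {..<n}"]) (auto simp: removable_def)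
  have fin: "finite (Dg c)" for c unfolding Dg_def by simp
  have mem: "(i, j) \<in> Dg c \<longleftrightarrow> j < n \<and> b j \<le> i \<and> i < c j" for i j c
    unfolding Dg_def columns_diagram_def by simp
  have subD: "?S E \<subseteq> Dg a" for E
    by (auto simp: mem shorten_def split: if_splits)
  have rim: "(i, j) \<in> Dg a - ?S E \<longleftrightarrow> j \<in> E \<and> i = a j - 1" if "E \<in> removable n a b" for i j E
    using that unfolding removable_def by (auto simp: mem shorten_def split: if_splits)
  define E where "E T = {j. j < n \<and> b j < a j \<and> T (a j - 1, j) = Suc N}" for T :: "nat \<times> nat \<Rightarrow> nat"
  \<comment> \<open>\<open>J\<close> deletes the largest entries and records their columns;
    \<open>I\<close> puts them back. Outside the diagram the value is \<open>undefined\<close>, as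
    extensional functions require.\<close>
  define J where "J T = (E T, restrict T (?S (E T)))" for T :: "nat \<times> nat \<Rightarrow> nat"
  define I where "I = (\<lambda>(E, T). \<lambda>c. if c \<in> ?S E then T c else if c \<in> Dg a then Suc N else undefined)"
  have EV: "E T \<in> removable n a b" if T: "T \<in> bounded_fillings (Dg a) (Suc N)" for T
  proof -
    note TD = bounded_fillingsD[OF T]
    have "k \<in> E T" if jk: "j < k" "k < n" "a j = a k" "j \<in> E T" for j k
    proof -
      have j: "b j < a j" "T (a j - 1, j) = Suc N" "j < n" using jk unfolding E_def by auto
      have bk: "b k < a k" using monotone_onD[OF b, of j k] jk j by simp
      then have c: "(a k - 1, j) \<in> Dg a" "(a k - 1, k) \<in> Dg a"
        using j jk by (auto simp: mem)
      have "Suc N \<le> T (a k - 1, k)" using TD(2)[OF c jk(1)] j jk by simp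
      moreover have "T (a k - 1, k) \<le> Suc N" using PiE_mem[OF TD(1) c(2)] by simp
      ultimately show ?thesis using bk jk unfolding E_def by simp
    qed
    then show ?thesis unfolding removable_def E_def by auto
  qed
  have top: "T c = Suc N \<longleftrightarrow> c \<notin> ?S (E T)" if T: "T \<in> bounded_fillings (Dg a) (Suc N)" and c: "c \<in> Dg a" for T c
  proof -
    note TD = bounded_fillingsD[OF T]
    obtain i j where ij: "c = (i, j)" by (cases c)
    have m: "j < n" "b j \<le> i" "i < a j" using c ij mem by auto
    have bot: "(a j - 1, j) \<in> Dg a" using m by (simp add: mem)
    have "T (a j - 1, j) \<le> Suc N" using PiE_mem[OF TD(1) bot] by simp
    then have "i = a j - 1" if "T c = Suc N"
      using TD(3)[of i j "a j - 1"] c bot ij that m by fastforce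
    then have "T c = Suc N \<longleftrightarrow> j \<in> E T \<and> i = a j - 1"
      using m ij unfolding E_def by auto
    then show ?thesis using rim[OF EV[OF T], of i j] c ij by auto
  qed
  have "(\<Sum>T\<in>bounded_fillings (Dg a) (Suc N). \<Prod>c\<in>Dg a. x (T c)) =
     (\<Sum>(F, T)\<in>Sigma (removable n a b) (\<lambda>F. bounded_fillings (?S F) N).
        x (Suc N) ^ card F * (\<Prod>c\<in>?S F. x (T c)))"
  proof (rule sum.reindex_bij_witness[where i = I and j = J])
    fix T assume T: "T \<in> bounded_fillings (Dg a) (Suc N)"
    note TD = bounded_fillingsD[OF T]
    show "I (J T) = T"
    proof
      fix c
      show "I (J T) c = T c"
        using top[OF T, of c] subD[of "E T"] PiE_arb[OF TD(1), of c] unfolding I_def J_def by auto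
    qed
    have "restrict T (?S (E T)) \<in> bounded_fillings (?S (E T)) N"
    proof (rule bounded_fillingsI)
      have "T c \<in> {1..N}" if "c \<in> ?S (E T)" for c
        using top[OF T, of c] subD[of "E T"] that PiE_mem[OF TD(1), of c] by fastforce
      then show "restrict T (?S (E T)) \<in> ?S (E T) \<rightarrow>\<^sub>E {1..N}" by auto
    next
      fix i j j' assume c: "(i, j) \<in> ?S (E T)" "(i, j') \<in> ?S (E T)" "j < j'"
      show "restrict T (?S (E T)) (i, j) \<le> restrict T (?S (E T)) (i, j')"
        using c TD(2)[of i j j'] subsetD[OF subD c(1)] subsetD[OF subD c(2)] by simp
    next
      fix i i' j assume c: "(i, j) \<in> ?S (E T)" "(i', j) \<in> ?S (E T)" "i < i'"
      show "restrict T (?S (E T)) (i, j) < restrict T (?S (E T)) (i', j)"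
        using c TD(3)[of i j i'] subsetD[OF subD c(1)] subsetD[OF subD c(2)] by simp
    qed
    then show "J T \<in> Sigma (removable n a b) (\<lambda>F. bounded_fillings (?S F) N)"
      unfolding J_def using EV[OF T] by simp
    have "(\<Prod>c\<in>Dg a. x (T c)) = (\<Prod>c\<in>Dg a - ?S (E T). x (T c)) * (\<Prod>c\<in>?S (E T). x (T c))"
      by (rule prod.subset_diff[OF subD fin])
    also have "(\<Prod>c\<in>Dg a - ?S (E T). x (T c)) = (\<Prod>c\<in>Dg a - ?S (E T). x (Suc N))"
    proof (rule prod.cong[OF refl])
      fix c assume "c \<in> Dg a - ?S (E T)"
      then have "T c = Suc N" using top[OF T, of c] by blast
      then show "x (T c) = x (Suc N)" by simp
    qed
    also have "Dg a - ?S (E T) = (\<lambda>j. (a j - 1, j)) ` E T"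
      using rim[OF EV[OF T]] by auto
    also have "(\<Prod>c\<in>(\<lambda>j. (a j - 1, j)) ` E T. x (Suc N)) = x (Suc N) ^ card (E T)"
      by (simp add: card_image inj_on_def)
    finally show "(case J T of (F, T) \<Rightarrow> x (Suc N) ^ card F * (\<Prod>c\<in>?S F. x (T c))) = (\<Prod>c\<in>Dg a. x (T c))"
      unfolding J_def by simp
  next
    fix p assume "p \<in> Sigma (removable n a b) (\<lambda>F. bounded_fillings (?S F) N)"
    then obtain F T where p: "p = (F, T)" and F: "F \<in> removable n a b"
      and T: "T \<in> bounded_fillings (?S F) N" by auto
    note TD = bounded_fillingsD[OF T]
    have Ip: "I p c = (if c \<in> ?S F then T c else if c \<in> Dg a then Suc N else undefined)" for c
      unfolding I_def p by simp
    have le: "T c \<le> N" "1 \<le> T c" if "c \<in> ?S F" for c using PiE_mem[OF TD(1) that] by auto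
    show "I p \<in> bounded_fillings (Dg a) (Suc N)"
    proof (rule bounded_fillingsI)
      show "I p \<in> Dg a \<rightarrow>\<^sub>E {1..Suc N}"
        using le subD[of F] by (fastforce simp: Ip PiE_def Pi_def extensional_def)
    next
      fix i j j' assume c: "(i, j) \<in> Dg a" "(i, j') \<in> Dg a" "j < j'"
      \<comment> \<open>A deleted cell left of a kept one in the same row would give both columns
        the same end, and then column \<open>j'\<close> would lose that cell too.\<close>
      have "(i, j) \<in> ?S F" if "(i, j') \<in> ?S F"
      proof (rule ccontr)
        assume "(i, j) \<notin> ?S F"
        then have j: "j \<in> F" "i = a j - 1" using rim[OF F] c(1) by auto
        have "a j = a j'" using c j monotone_onD[OF a, of j j'] by (auto simp: mem)
        then have "j' \<in> F" using F j c unfolding removable_def by (auto simp: mem)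
        then show False using that j \<open>a j = a j'\<close> by (simp add: mem shorten_def)
      qed
      then show "I p (i, j) \<le> I p (i, j')"
        using c TD(2)[of i j j'] le[of "(i, j)"] by (auto simp: Ip)
    next
      fix i i' j assume c: "(i, j) \<in> Dg a" "(i', j) \<in> Dg a" "i < i'"
      then have "(i, j) \<in> ?S F" by (auto simp: mem shorten_def)
      then show "I p (i, j) < I p (i', j)"
        using c TD(3)[of i j i'] le[of "(i, j)"] by (auto simp: Ip)
    qed
    have "E (I p) = F"
    proof -
      have "j \<in> E (I p) \<longleftrightarrow> j \<in> F" for j
      proof (cases "j < n \<and> b j < a j")
        case True
        then have c: "(a j - 1, j) \<in> Dg a" by (auto simp: mem)
        have "I p (a j - 1, j) = Suc N \<longleftrightarrow> (a j - 1, j) \<notin> ?S F"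
          using le[of "(a j - 1, j)"] c by (auto simp: Ip)
        then show ?thesis using True c rim[OF F, of "a j - 1" j] unfolding E_def by auto
      next
        case False
        then show ?thesis using F unfolding E_def removable_def by auto
      qed
      then show ?thesis by blast
    qed
    moreover have "restrict (I p) (?S F) = T"
      using TD(1) by (auto simp: Ip restrict_def PiE_def extensional_def)
    ultimately show "J (I p) = p" unfolding J_def p by simp
  qed
  also have "\<dots> = (\<Sum>F\<in>removable n a b. \<Sum>T\<in>bounded_fillings (?S F) N.
        x (Suc N) ^ card F * (\<Prod>c\<in>?S F. x (T c)))"
    by (subst sum.Sigma) (auto simp: finrem finite_bounded_fillings fin)
  finally show ?thesis by (simp add: sum_distrib_left)
qed

section \<open>Jacobi-Trudi determinants and their recursion in the number of variables\<close>

lemma permutes_less_upt: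
  fixes p :: "nat \<Rightarrow> nat"
  assumes "p permutes {0..<n}" "i < n"
  shows "p i < n"
  using permutes_in_image[OF assms(1), of i] assms(2) by simp

definition jt_det :: "(int \<Rightarrow> 'a::comm_ring_1) \<Rightarrow> nat \<Rightarrow> (nat \<Rightarrow> int) \<Rightarrow> (nat \<Rightarrow> int) \<Rightarrow> 'a" where
  "jt_det f n u v = det (mat n n (\<lambda>(i, j). f (u i - v j)))"

lemma jt_det_sum:
  "jt_det f n u v = (\<Sum>p | p permutes {0..<n}. signof p * (\<Prod>i = 0..<n. f (u i - v (p i))))"
proof -
  have "(\<Prod>i = 0..<n. mat n n (\<lambda>(i, j). f (u i - v j)) $$ (i, p i)) = (\<Prod>i = 0..<n. f (u i - v (p i)))"
    if "p permutes {0..<n}" for p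
    using that by (intro prod.cong) (auto simp: permutes_less_upt)
  then show ?thesis
    unfolding jt_det_def by (subst det_def'[of _ n]) (auto intro!: sum.cong)
qed

lemma jt_det_identical_rows:
  "\<lbrakk>i < n; k < n; i \<noteq> k; u i = u k\<rbrakk> \<Longrightarrow> jt_det f n u v = 0"
  unfolding jt_det_def
  by (rule det_identical_rows[of _ n i k]) (auto intro!: eq_vecI)

text \<open>All entries in rows from \<open>j\<close> on and columns up to \<open>j\<close> vanish
  by monotonicity. Every permutation meets this block, since \<open>n - j\<close> rows do not fit
  into the \<open>n - j - 1\<close> remaining columns.\<close>

lemma jt_det_eq_0_if_less:
  assumes neg: "\<And>k. k < 0 \<Longrightarrow> f k = 0"
    and u: "\<And>i k. i \<le> k \<Longrightarrow> k < n \<Longrightarrow> u k \<le> u i" and v: "\<And>i k. i \<le> k \<Longrightarrow> k < n \<Longrightarrow> v k \<le> v i"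
    and j: "j < n" "u j < v j"
  shows "jt_det f n u v = 0"
  unfolding jt_det_sum
proof (rule sum.neutral, safe)
  fix p assume p: "p permutes {0..<n}"
  have "\<exists>i. j \<le> i \<and> i < n \<and> p i \<le> j"
  proof (rule ccontr)
    assume "\<nexists>i. j \<le> i \<and> i < n \<and> p i \<le> j"
    then have "p ` {j..<n} \<subseteq> {Suc j..<n}" using permutes_less_upt[OF p] by force
    then have "card (p ` {j..<n}) \<le> card {Suc j..<n}" by (rule card_mono[rotated]) simp
    then show False using j permutes_inj_on[OF p] by (simp add: card_image)
  qed
  then obtain i where i: "j \<le> i" "i < n" "p i \<le> j" by blast
  have "u i - v (p i) < 0" using u[OF i(1,2)] v[OF i(3) j(1)] j by simp
  then have "\<exists>i\<in>{0..<n}. f (u i - v (p i)) = 0" using i neg by force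
  then have "(\<Prod>i = 0..<n. f (u i - v (p i))) = 0" by (intro prod_zero) auto
  then show "signof p * (\<Prod>i = 0..<n. f (u i - v (p i))) = (0::'a)" by simp
qed

text \<open>In each row the recursion for \<open>esym\<close> offers two terms, the second with
  \<open>u i\<close> lowered by one. \<open>E\<close> collects the rows where the second term is
  taken when the products are expanded.\<close>

lemma jt_det_esym_Suc:
  "jt_det (esym x (Suc N)) n u v =
    (\<Sum>E\<in>Pow {0..<n}. x (Suc N) ^ card E * jt_det (esym x N) n (\<lambda>i. if i \<in> E then u i - 1 else u i) v)"
proof -
  let ?u = "\<lambda>E i. if i \<in> E then u i - 1 else u i"
  have "(\<Prod>i = 0..<n. esym x (Suc N) (u i - v (p i)))
      = (\<Sum>E\<in>Pow {0..<n}. x (Suc N) ^ card E * (\<Prod>i = 0..<n. esym x N (?u E i - v (p i))))" for p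
  proof -
    have "(\<Prod>i = 0..<n. esym x (Suc N) (u i - v (p i)))
      = (\<Prod>i = 0..<n. x (Suc N) * esym x N (u i - 1 - v (p i)) + esym x N (u i - v (p i)))"
      by (simp add: algebra_simps)
    also have "\<dots> = (\<Sum>E\<in>Pow {0..<n}. (\<Prod>i\<in>E. x (Suc N) * esym x N (u i - 1 - v (p i)))
        * (\<Prod>i\<in>{0..<n} - E. esym x N (u i - v (p i))))"
      by (rule prod_add) simp
    also have "\<dots> = (\<Sum>E\<in>Pow {0..<n}. x (Suc N) ^ card E * (\<Prod>i = 0..<n. esym x N (?u E i - v (p i))))"
    proof (rule sum.cong[OF refl])
      fix E assume E: "E \<in> Pow {0..<n}"
      have "(\<Prod>i = 0..<n. esym x N (?u E i - v (p i)))
        = (\<Prod>i\<in>{0..<n} - E. esym x N (?u E i - v (p i))) * (\<Prod>i\<in>E. esym x N (?u E i - v (p i)))"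
        by (rule prod.subset_diff) (use E in auto)
      also have "\<dots> = (\<Prod>i\<in>{0..<n} - E. esym x N (u i - v (p i))) * (\<Prod>i\<in>E. esym x N (u i - 1 - v (p i)))"
        by (intro arg_cong2[where f = "(*)"] prod.cong) auto
      finally show "(\<Prod>i\<in>E. x (Suc N) * esym x N (u i - 1 - v (p i)))
        * (\<Prod>i\<in>{0..<n} - E. esym x N (u i - v (p i)))
        = x (Suc N) ^ card E * (\<Prod>i = 0..<n. esym x N (?u E i - v (p i)))"
        by (simp add: prod.distrib algebra_simps)
    qed
    finally show ?thesis .
  qed
  then show ?thesis
    unfolding jt_det_sum by (simp only: sum_distrib_left) (subst sum.swap, simp only: ac_simps)
qed

text \<open>Shifted column ends, strictly decreasing in \<open>j\<close>. Their differences are the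
  usual indices \<open>a i - b j - i + j\<close> of the dual Jacobi-Trudi matrix.\<close>

definition beta :: "(nat \<Rightarrow> nat) \<Rightarrow> nat \<Rightarrow> int" where
  "beta a j = int (a j) - int j"

lemma beta_strict_decreasing: "antimono_on {..<n} a \<Longrightarrow> j < k \<Longrightarrow> k < n \<Longrightarrow> beta a k < beta a j"
  unfolding beta_def using monotone_onD[of "{..<n}" "(\<le>)" "(\<ge>)" a j k] by simp

lemma inj_on_beta: "antimono_on {..<n} a \<Longrightarrow> inj_on (beta a) {..<n}"
  by (rule inj_onI) (metis beta_strict_decreasing lessThan_iff linorder_neqE_nat order_less_irrefl)

text \<open>Without variables only index \<open>0\<close> survives, so a contributing
  \<open>p\<close> matches \<open>beta a i\<close> with \<open>beta b (p i)\<close> for all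
  \<open>i\<close>. Summing over \<open>i\<close>, the nonnegative differences
  \<open>beta a i - beta b i\<close> add up to zero; hence \<open>a\<close> and \<open>b\<close>
  agree below \<open>n\<close>, and injectivity forces \<open>p = id\<close>.\<close>

lemma jt_det_esym_0:
  assumes a: "antimono_on {..<n} a" and b: "antimono_on {..<n} b" and ba: "\<And>j. j < n \<Longrightarrow> b j \<le> a j"
  shows "jt_det (esym x 0) n (beta a) (beta b) = (if \<forall>j<n. a j = b j then 1 else 0)"
proof -
  have prod: "(\<Prod>i = 0..<n. esym x 0 (beta a i - beta b (p i))) = 
      (if p = id \<and> (\<forall>j<n. a j = b j) then 1 else 0)" if p: "p permutes {0..<n}" for p
  proof (cases "\<forall>i<n. beta a i = beta b (p i)")
    case True
    have "(\<Sum>i = 0..<n. beta b (p i)) = (\<Sum>i = 0..<n. beta b i)"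
      by (rule sum.permute[OF p, of "beta b", unfolded comp_def, symmetric])
    then have "(\<Sum>i = 0..<n. beta a i - beta b i) = 0"
      using True by (simp add: sum_subtractf)
    moreover have "0 \<le> beta a i - beta b i" if "i \<in> {0..<n}" for i
      using that ba[of i] unfolding beta_def by simp
    ultimately have eq: "beta a i = beta b i" if "i < n" for i
      using that sum_nonneg_eq_0_iff[of "{0..<n}" "\<lambda>i. beta a i - beta b i"] by simp
    then have ab: "\<forall>j<n. a j = b j" unfolding beta_def by simp
    have "p i = i" for i
    proof (cases "i < n")
      case True
      then have "beta b (p i) = beta b i" using eq[OF True] \<open>\<forall>i<n. beta a i = beta b (p i)\<close> by simp
      then show ?thesis using inj_onD[OF inj_on_beta[OF b]] True permutes_less_upt[OF p True] by simp
    next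
      case False
      then show ?thesis using p by (simp add: permutes_def)
    qed
    then show ?thesis using ab True by (auto simp: fun_eq_iff)
  next
    case False
    then have "(\<Prod>i = 0..<n. esym x 0 (beta a i - beta b (p i))) = 0"
      by (intro prod_zero) auto
    moreover have "\<not> (p = id \<and> (\<forall>j<n. a j = b j))" using False by (auto simp: beta_def)
    ultimately show ?thesis by simp
  qed
  have "jt_det (esym x 0) n (beta a) (beta b)
      = (\<Sum>p | p permutes {0..<n}. if p = id \<and> (\<forall>j<n. a j = b j) then 1 else 0)"
    unfolding jt_det_sum by (rule sum.cong[OF refl]) (use prod in \<open>auto simp: sign_id\<close>)
  also have "\<dots> = (if \<forall>j<n. a j = b j then 1 else 0)"
  proof -
    have "(\<Sum>p | p permutes {0..<n}. if p = id \<and> Q then 1 else 0) = (if Q then 1 else (0::'b::comm_ring_1))" for Q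
      using permutes_id[of "{0..<n}"] by (cases Q) (simp_all add: finite_permutations)
    then show ?thesis .
  qed
  finally show ?thesis .
qed

lemma shorten_antimono:
  assumes a: "antimono_on {..<n} a" and E: "E \<in> removable n a b"
  shows "antimono_on {..<n} (shorten E a)"
proof (rule monotone_onI)
  fix j k assume jk: "j \<in> {..<n}" "k \<in> {..<n}" "j \<le> k"
  then have le: "a k \<le> a j" using monotone_onD[OF a] by simp
  show "shorten E a k \<le> shorten E a j"
  proof (cases "j = k")
    case False
    then have "k \<in> E" if "a j = a k" "j \<in> E" using E jk that le_neq_implies_less unfolding removable_def by blast
    then show ?thesis using le unfolding shorten_def by (cases "a j = a k") auto
  qed simp
qed

lemma jt_det_cong: "(\<And>i. i < n \<Longrightarrow> u i = w i) \<Longrightarrow> jt_det f n u v = jt_det f n w v"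
  unfolding jt_det_sum by (intro sum.cong refl arg_cong2[where f = "(*)"] prod.cong) auto

text \<open>
  Splitting off the last variable replaces each row index \<open>u i\<close> by \<open>u i\<close> or \<open>u i - 1\<close>. The choices that
  do not come from removing a horizontal strip produce two equal rows or a zero block.
\<close>
lemma jt_det_eq_0_if_not_removable:
  assumes a: "antimono_on {..<n} a" and b: "antimono_on {..<n} b"
    and E: "E \<subseteq> {..<n}" "E \<notin> removable n a b" and ba: "\<And>j. j < n \<Longrightarrow> b j \<le> a j"
  shows "jt_det (esym x N) n (\<lambda>i. if i \<in> E then beta a i - 1 else beta a i) (beta b) = 0"
proof (cases "\<forall>j\<in>E. b j < a j")
  case True
  then obtain j k where jk: "j < k" "k < n" "a j = a k" "j \<in> E" "k \<notin> E"
    using E unfolding removable_def by auto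
  \<comment> \<open>Membership in \<open>E\<close> is lost between two adjacent columns with the
    same end. Lowering row \<open>i\<close> by one then makes it equal to row
    \<open>Suc i\<close>.\<close>
  have "\<exists>i\<ge>j. i < k \<and> i \<in> E \<and> Suc i \<notin> E"
  proof (rule ccontr)
    assume "\<not> (\<exists>i\<ge>j. i < k \<and> i \<in> E \<and> Suc i \<notin> E)"
    then have "k \<in> E"
      by (intro dec_induct[of j k "\<lambda>i. i \<in> E"]) (use jk in auto)
    then show False using jk by simp
  qed
  then obtain i where i: "j \<le> i" "i < k" "i \<in> E" "Suc i \<notin> E" by blast
  have "a k \<le> a (Suc i)" "a (Suc i) \<le> a i" "a i \<le> a j"
    using i jk monotone_onD[OF a, of "Suc i" k] monotone_onD[OF a, of i "Suc i"] monotone_onD[OF a, of j i] by auto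
  then have "beta a (Suc i) = beta a i - 1" unfolding beta_def using jk by simp
  then show ?thesis
    by (intro jt_det_identical_rows[of i _ "Suc i"]) (use i jk in auto)
next
  case False
  then obtain j where j: "j \<in> E" "a j \<le> b j" by force
  then have "j < n" using E by auto
  show ?thesis
  proof (rule jt_det_eq_0_if_less[OF esym_neg _ _ \<open>j < n\<close>])
    show "(if j \<in> E then beta a j - 1 else beta a j) < beta b j"
      using j unfolding beta_def by simp
    show "(if k \<in> E then beta a k - 1 else beta a k) \<le> (if i \<in> E then beta a i - 1 else beta a i)"
      if "i \<le> k" "k < n" for i k
      using beta_strict_decreasing[OF a, of i k] that by (cases "i = k") auto
    show "beta b k \<le> beta b i" if "i \<le> k" "k < n" for i k
      using beta_strict_decreasing[OF b, of i k] that by (cases "i = k") auto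
  qed
qed

text \<open>Both sides satisfy the same recursion in the last variable. The determinant side has
  extra terms for all column sets that are not removable, and these vanish.\<close>

lemma dual_jacobi_trudi:
  fixes x :: "nat \<Rightarrow> 'a::comm_ring_1"
  assumes "antimono_on {..<n} a" and "antimono_on {..<n} b" and "\<And>j. j < n \<Longrightarrow> b j \<le> a j"
  shows "(\<Sum>T\<in>bounded_fillings (columns_diagram n a b) N. \<Prod>c\<in>columns_diagram n a b. x (T c))
    = jt_det (esym x N) n (beta a) (beta b)"
  using assms
proof (induction N arbitrary: a)
  case 0
  show ?case
  proof (cases "columns_diagram n a b = {}")
    case True
    have "a j = b j" if "j < n" for j
    proof (rule antisym[OF _ 0(3)[OF that]])
      have "(b j, j) \<notin> columns_diagram n a b" using True by blast
      then show "a j \<le> b j" using that unfolding columns_diagram_def by simp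
    qed
    moreover have "bounded_fillings {} 0 = {\<lambda>_. undefined}"
      unfolding bounded_fillings_def column_strict_fillings_def by auto
    ultimately show ?thesis using True jt_det_esym_0[OF 0] by (simp del: esym.simps)
  next
    case False
    then have "\<not> (\<forall>j<n. a j = b j)" unfolding columns_diagram_def by auto
    moreover have "bounded_fillings (columns_diagram n a b) 0 = {}"
      using False bounded_fillings_subset[of "columns_diagram n a b" 0] by auto
    ultimately show ?thesis using jt_det_esym_0[OF 0, of x] by (simp only: sum.empty if_False)
  qed
next
  case (Suc N)
  note a = Suc.prems(1) and b = Suc.prems(2) and ba = Suc.prems(3)
  have rem_sub: "removable n a b \<subseteq> Pow {0..<n}" unfolding removable_def by auto
  have "(\<Sum>T\<in>bounded_fillings (columns_diagram n a b) (Suc N). \<Prod>c\<in>columns_diagram n a b. x (T c))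
    = (\<Sum>E\<in>removable n a b. x (Suc N) ^ card E * (\<Sum>T\<in>bounded_fillings (columns_diagram n (shorten E a) b) N.
        \<Prod>c\<in>columns_diagram n (shorten E a) b. x (T c)))"
    by (rule sum_bounded_fillings_Suc[OF a b ba])
  also have "\<dots> = (\<Sum>E\<in>removable n a b.
      x (Suc N) ^ card E * jt_det (esym x N) n (\<lambda>i. if i \<in> E then beta a i - 1 else beta a i) (beta b))"
  proof (intro sum.cong refl arg_cong2[where f = "(*)"])
    fix E assume E: "E \<in> removable n a b"
    have "b j \<le> shorten E a j" if "j < n" for j
      using E ba[OF that] unfolding removable_def shorten_def by fastforce
    note Suc.IH[OF shorten_antimono[OF a E] b this]
    moreover have "beta (shorten E a) i = (if i \<in> E then beta a i - 1 else beta a i)" for i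
      using E unfolding removable_def shorten_def beta_def by fastforce
    ultimately show "(\<Sum>T\<in>bounded_fillings (columns_diagram n (shorten E a) b) N.
        \<Prod>c\<in>columns_diagram n (shorten E a) b. x (T c))
      = jt_det (esym x N) n (\<lambda>i. if i \<in> E then beta a i - 1 else beta a i) (beta b)"
      by (simp cong: jt_det_cong)
  qed
  also have "\<dots> = jt_det (esym x (Suc N)) n (beta a) (beta b)"
    unfolding jt_det_esym_Suc
    by (rule sum.mono_neutral_left[OF _ rem_sub])
      (auto simp: atLeast0LessThan jt_det_eq_0_if_not_removable[OF a b _ _ ba])
  finally show ?case .
qed

text \<open>Fillings are grouped by monomial over a finite set \<open>S\<close> covering both
  diagrams. A monomial in \<open>S\<close> has indices at most \<open>N\<close>, so any filling with
  that monomial is bounded and its coefficient is the full \<open>skew_schur\<close>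
  coefficient.\<close>

lemma skew_equivalent_eval:
  fixes x :: "nat \<Rightarrow> 'a::comm_ring_1"
  assumes fin: "finite D1" "finite D2" and eq: "skew_equivalent D1 D2"
  shows "(\<Sum>T\<in>bounded_fillings D1 N. \<Prod>c\<in>D1. x (T c)) = (\<Sum>T\<in>bounded_fillings D2 N. \<Prod>c\<in>D2. x (T c))"
proof -
  define S where "S = filling_monomial D1 ` bounded_fillings D1 N \<union> filling_monomial D2 ` bounded_fillings D2 N"
  have finS: "finite S" unfolding S_def using fin finite_bounded_fillings by blast
  have set_fm: "set_mset (filling_monomial D T) = T ` D" if "finite D" for D T
    unfolding filling_monomial_def using that by simp
  have SN: "set_mset M \<subseteq> {..N}" if M: "M \<in> S" for M
  proof -
    consider T where "T \<in> bounded_fillings D1 N" "M = filling_monomial D1 T"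
      | T where "T \<in> bounded_fillings D2 N" "M = filling_monomial D2 T"
      using M unfolding S_def by blast
    then show ?thesis
      by cases (simp_all add: set_fm fin bounded_fillings_def)
  qed
  have "(\<Sum>T\<in>bounded_fillings D N. \<Prod>c\<in>D. x (T c)) = (\<Sum>M\<in>S. of_int (skew_schur D M) * prod_mset (image_mset x M))"
    if D: "finite D" "filling_monomial D ` bounded_fillings D N \<subseteq> S" for D
  proof -
    have prod: "(\<Prod>c\<in>D. x (T c)) = prod_mset (image_mset x (filling_monomial D T))" for T
      unfolding filling_monomial_def prod_unfold_prod_mset by (simp add: multiset.map_comp comp_def)
    have "(\<Sum>T\<in>bounded_fillings D N. \<Prod>c\<in>D. x (T c))
      = (\<Sum>M\<in>S. \<Sum>T\<in>{T \<in> bounded_fillings D N. filling_monomial D T = M}. \<Prod>c\<in>D. x (T c))"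
      by (rule sum.group[symmetric]) (use D finS finite_bounded_fillings in auto)
    also have "\<dots> = (\<Sum>M\<in>S. of_int (skew_schur D M) * prod_mset (image_mset x M))"
    proof (rule sum.cong[OF refl])
      fix M assume M: "M \<in> S"
      have "{T \<in> bounded_fillings D N. filling_monomial D T = M} = {T \<in> column_strict_fillings D. filling_monomial D T = M}"
        using SN[OF M] set_fm[OF D(1)] unfolding bounded_fillings_def by auto
      then show "(\<Sum>T\<in>{T \<in> bounded_fillings D N. filling_monomial D T = M}. \<Prod>c\<in>D. x (T c))
        = of_int (skew_schur D M) * prod_mset (image_mset x M)"
        unfolding skew_schur_def prod by simp
    qed
    finally show ?thesis .
  qed
  then show ?thesis using fin eq unfolding skew_equivalent_def S_def by simp
qed

section \<open>The lowest term of the specialised determinant\<close>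

text \<open>The permutations whose product in the determinant has no factor of negative
  index.\<close>

definition feasible :: "nat \<Rightarrow> (nat \<Rightarrow> int) \<Rightarrow> (nat \<Rightarrow> int) \<Rightarrow> (nat \<Rightarrow> nat) set" where
  "feasible n u v = {p. p permutes {0..<n} \<and> (\<forall>i<n. v (p i) \<le> u i)}"

text \<open>The summand \<open>m\<close> counts positive indices; the square makes the weight
  strictly convex on them, which breaks ties between permutations.\<close>

definition weight :: "nat \<Rightarrow> int \<Rightarrow> nat" where
  "weight m k = (if k \<le> 0 then 0 else m + nat k ^ 2)"

definition perm_weight :: "nat \<Rightarrow> nat \<Rightarrow> (nat \<Rightarrow> int) \<Rightarrow> (nat \<Rightarrow> int) \<Rightarrow> (nat \<Rightarrow> nat) \<Rightarrow> nat" where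
  "perm_weight m n u v p = (\<Sum>i = 0..<n. weight m (u i - v (p i)))"

lemma int_weight: "0 < k \<Longrightarrow> int (weight m k) = int m + k\<^sup>2"
  unfolding weight_def by simp

lemma finite_feasible: "finite (feasible n u v)"
  by (rule finite_subset[OF _ finite_permutations[of "{0..<n}"]]) (auto simp: feasible_def)

text \<open>Exchange argument: composing \<open>p\<close> with the transposition of \<open>i\<close>
  and \<open>k\<close> changes only two summands.\<close>

lemma feasible_swap_weight:
  assumes p: "p \<in> feasible n u v" and ik: "i < n" "k < n" "i \<noteq> k"
    and le: "v (p k) \<le> u i" "v (p i) \<le> u k"
    and less: "weight m (u i - v (p k)) + weight m (u k - v (p i))
      < weight m (u i - v (p i)) + weight m (u k - v (p k))"
  shows "\<exists>q\<in>feasible n u v. perm_weight m n u v q < perm_weight m n u v p"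
proof
  define q where "q = p \<circ> transpose i k"
  have qi: "q i = p k" "q k = p i" and qj: "\<And>j. j \<noteq> i \<Longrightarrow> j \<noteq> k \<Longrightarrow> q j = p j"
    unfolding q_def by (auto simp: transpose_def)
  have "q permutes {0..<n}"
    unfolding q_def using p ik
    by (intro permutes_compose permutes_swap_id) (auto simp: feasible_def)
  moreover have "v (q j) \<le> u j" if "j < n" for j
    using that p le qi qj[of j] unfolding feasible_def by (cases "j = i"; cases "j = k") auto
  ultimately show "q \<in> feasible n u v" unfolding feasible_def by blast
  have split: "perm_weight m n u v r = weight m (u i - v (r i)) + (weight m (u k - v (r k))
      + (\<Sum>j\<in>{0..<n} - {i} - {k}. weight m (u j - v (r j))))" for r
    unfolding perm_weight_def using ik
    by (subst sum.remove[of _ i], simp, simp, subst sum.remove[of _ k]) auto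
  have "(\<Sum>j\<in>{0..<n} - {i} - {k}. weight m (u j - v (q j))) = (\<Sum>j\<in>{0..<n} - {i} - {k}. weight m (u j - v (p j)))"
    by (rule sum.cong) (auto simp: qj)
  then show "perm_weight m n u v q < perm_weight m n u v p"
    unfolding split[of p] split[of q] qi using less by simp
qed

text \<open>\<open>K\<close> bounds all indices. The bound on \<open>n * K^2\<close> lets division
  by \<open>m\<close> read off the number of positive indices; the bound on \<open>2 * K^2\<close>
  makes it cheaper to merge two positive indices into one.\<close>

locale beta_pair =
  fixes n :: nat and u v :: "nat \<Rightarrow> int" and K m :: nat
  assumes u_less: "\<And>i k. i < k \<Longrightarrow> k < n \<Longrightarrow> u k < u i"
    and v_less: "\<And>i k. i < k \<Longrightarrow> k < n \<Longrightarrow> v k < v i"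
    and v_le_u: "\<And>i. i < n \<Longrightarrow> v i \<le> u i"
    and diff_le: "\<And>i j. i < n \<Longrightarrow> j < n \<Longrightarrow> u i - v j \<le> int K"
    and m_large: "n * K\<^sup>2 < m" "2 * K\<^sup>2 < m"
begin

section \<open>Permutations of minimal weight\<close>

definition unmatched :: "nat set" where
  "unmatched = {i. i < n \<and> u i \<notin> v ` {0..<n}}"

definition minimal :: "(nat \<Rightarrow> nat) \<Rightarrow> bool" where
  "minimal p \<longleftrightarrow> p \<in> feasible n u v \<and> (\<forall>q\<in>feasible n u v. perm_weight m n u v p \<le> perm_weight m n u v q)"

lemma inj_on_v: "inj_on v {0..<n}"
  by (rule inj_onI) (metis atLeastLessThan_iff linorder_neqE_nat order_less_irrefl v_less)

text \<open>Otherwise some \<open>k\<close> takes the partner of \<open>i\<close>. Swapping replaces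
  positive indices \<open>s\<close>, \<open>t\<close> by \<open>0\<close> and \<open>s + t\<close>,
  which saves \<open>m\<close> and costs only \<open>2 * s * t\<close>, at most
  \<open>2 * K^2\<close>.\<close>

lemma minimal_matched:
  assumes p: "minimal p" and i: "i < n" "i \<notin> unmatched"
  shows "v (p i) = u i"
proof (rule ccontr)
  assume ne: "v (p i) \<noteq> u i"
  have perm: "p permutes {0..<n}" and feas: "p \<in> feasible n u v" and le: "\<And>i. i < n \<Longrightarrow> v (p i) \<le> u i"
    using p unfolding minimal_def feasible_def by auto
  obtain j where j: "j < n" "v j = u i" using i unfolding unmatched_def by auto
  obtain k where k: "k < n" "p k = j"
    using permutes_image[OF perm] j(1) by (metis atLeastLessThan_iff imageE le0)
  have "k \<noteq> i" using k j ne by auto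
  then have "u k \<noteq> u i" using u_less[of i k] u_less[of k i] i k by (cases i k rule: linorder_cases) auto
  define s where "s = u i - v (p i)"
  define t where "t = u k - u i"
  have s: "0 < s" using le[OF i(1)] ne unfolding s_def by simp
  have t: "0 < t" using le[OF k(1)] k j \<open>u k \<noteq> u i\<close> unfolding t_def by simp
  have st: "s \<le> int K" "t \<le> int K"
    using diff_le[OF i(1) permutes_less_upt[OF perm i(1)]] diff_le[OF k(1) j(1)] j unfolding s_def t_def by auto
  have "s * t \<le> int K * int K" using st s t by (intro mult_mono) auto
  moreover have "int (2 * K\<^sup>2) < int m" using m_large(2) by (rule of_nat_less_iff[THEN iffD2])
  ultimately have "2 * (s * t) < int m" by (simp add: power2_eq_square)
  then have "int (weight m (s + t)) < int (weight m s) + int (weight m t)"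
    using s t by (simp add: int_weight power2_sum)
  then have "weight m 0 + weight m (t + s) < weight m s + weight m t"
    by (simp add: weight_def[of m 0] add.commute)
  then have "\<exists>q\<in>feasible n u v. perm_weight m n u v q < perm_weight m n u v p"
    using j k s t unfolding s_def t_def
    by (intro feasible_swap_weight[OF feas i(1) k(1)]) (auto simp: \<open>k \<noteq> i\<close>[symmetric] algebra_simps)
  then show False using p unfolding minimal_def by (auto simp: not_le[symmetric])
qed

text \<open>An inversion among unmatched rows can be undone. All four indices involved are positive,
  so the \<open>m\<close> terms cancel and the squares decide.\<close>

lemma minimal_strict_mono:
  assumes p: "minimal p" and ik: "i \<in> unmatched" "k \<in> unmatched" "i < k"
  shows "p i < p k"
proof (rule ccontr)
  assume "\<not> p i < p k"
  have perm: "p permutes {0..<n}" and feas: "p \<in> feasible n u v" and le: "\<And>i. i < n \<Longrightarrow> v (p i) \<le> u i"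
    using p unfolding minimal_def feasible_def by auto
  have n: "i < n" "k < n" using ik unfolding unmatched_def by auto
  have "p i \<noteq> p k" using permutes_inj[OF perm] ik by (auto dest: injD)
  then have "v (p i) < v (p k)"
    using v_less[of "p k" "p i"] \<open>\<not> p i < p k\<close> permutes_less_upt[OF perm n(1)] by simp
  have "u k < u i" using u_less n ik by blast
  have ne: "v (p j) \<noteq> u i" "v (p j) \<noteq> u k" if "j < n" for j
    using ik permutes_less_upt[OF perm that] unfolding unmatched_def by force+
  have le': "v (p k) \<le> u k" "v (p k) \<noteq> u k" using le[OF n(2)] ne[OF n(2)] by auto
  \<comment> \<open>The swap lowers the weight by twice this product.\<close>
  have "0 < (u i - u k) * (v (p k) - v (p i))"
    using \<open>v (p i) < v (p k)\<close> \<open>u k < u i\<close> by simp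
  then have "int (weight m (u i - v (p k))) + int (weight m (u k - v (p i)))
      < int (weight m (u i - v (p i))) + int (weight m (u k - v (p k)))"
    using le' \<open>v (p i) < v (p k)\<close> \<open>u k < u i\<close>
    by (simp add: int_weight power2_eq_square algebra_simps)
  then have "\<exists>q\<in>feasible n u v. perm_weight m n u v q < perm_weight m n u v p"
    using le' \<open>v (p i) < v (p k)\<close> \<open>u k < u i\<close> ik(3)
    by (intro feasible_swap_weight[OF feas n]) auto
  then show False using p unfolding minimal_def by (auto simp: not_le[symmetric])
qed

text \<open>Minimal permutations agree off \<open>unmatched\<close>, hence send
  \<open>unmatched\<close> onto the same set, and an increasing bijection between two finite sets of
  numbers is unique.\<close>

lemma minimal_unique:
  assumes p: "minimal p" and q: "minimal q"
  shows "p = q"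
proof
  have pp: "p permutes {0..<n}" and qp: "q permutes {0..<n}"
    using p q unfolding minimal_def feasible_def by auto
  have out: "p i = q i" if "i \<notin> unmatched" for i
  proof (cases "i < n")
    case True
    then have "v (p i) = v (q i)" using minimal_matched[OF p True that] minimal_matched[OF q True that] by simp
    then show ?thesis
      using inj_onD[OF inj_on_v] permutes_less_upt[OF pp True] permutes_less_upt[OF qp True] by simp
  next
    case False
    then show ?thesis using pp qp by (simp add: permutes_def)
  qed
  have img: "\<exists>k\<in>unmatched. r k = s i" if rs: "r permutes {0..<n}" "s permutes {0..<n}"
    and ag: "\<And>i. i \<notin> unmatched \<Longrightarrow> r i = s i" and i: "i \<in> unmatched" for r s i
  proof -
    obtain k where k: "r k = s i" using permutes_surj[OF rs(1)] by (metis surjD)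
    have "k \<in> unmatched"
    proof (rule ccontr)
      assume "k \<notin> unmatched"
      then have "s k = s i" using ag k by simp
      then show False using permutes_inj[OF rs(2)] \<open>k \<notin> unmatched\<close> i by (auto dest: injD)
    qed
    then show ?thesis using k by blast
  qed
  fix i
  show "p i = q i"
  proof (induction i rule: less_induct)
    case (less i)
    \<comment> \<open>If \<open>r i < s i\<close>, then \<open>s\<close> takes the value
      \<open>r i\<close> at an unmatched \<open>k\<close>, and \<open>k < i\<close> by monotonicity.
      There \<open>r\<close> and \<open>s\<close> agree, so \<open>r\<close> would take this value
      twice.\<close>
    have key: "\<not> r i < s i" if r: "minimal r" "r permutes {0..<n}" and s: "minimal s" "s permutes {0..<n}"
      and ag: "\<And>i. i \<notin> unmatched \<Longrightarrow> s i = r i" and IH: "\<And>k. k < i \<Longrightarrow> s k = r k" 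
      and i: "i \<in> unmatched" for r s
    proof
      assume lt: "r i < s i"
      obtain k where k: "k \<in> unmatched" "s k = r i" using img[OF s(2) r(2) ag i] by blast
      have "k < i"
        using minimal_strict_mono[OF s(1) i k(1)] lt k by (cases k i rule: linorder_cases) auto
      then have "r k = r i" using IH k by simp
      then show False using permutes_inj[OF r(2)] \<open>k < i\<close> by (auto dest: injD)
    qed
    show ?case
    proof (cases "i \<in> unmatched")
      case True
      have "\<not> p i < q i" "\<not> q i < p i"
        using key[OF p pp q qp _ _ True] key[OF q qp p pp _ _ True] out less.IH by metis+
      then show ?thesis by simp
    qed (rule out)
  qed
qed

lemma id_feasible: "id \<in> feasible n u v"
  unfolding feasible_def using v_le_u by (auto simp: permutes_id)

lemma ex_minimal: "\<exists>p. minimal p"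
  unfolding minimal_def
  using ex_has_least_nat[of "\<lambda>p. p \<in> feasible n u v" id "perm_weight m n u v"] id_feasible by blast

text \<open>Matched rows have weight zero, unmatched rows contribute \<open>m\<close> plus a square,
  and the squares together stay below \<open>m\<close>.\<close>

lemma perm_weight_minimal:
  assumes p: "minimal p"
  shows "perm_weight m n u v p div m = card unmatched"
proof -
  have perm: "p permutes {0..<n}" and le: "\<And>i. i < n \<Longrightarrow> v (p i) \<le> u i"
    using p unfolding minimal_def feasible_def by auto
  have sub: "unmatched \<subseteq> {0..<n}" unfolding unmatched_def by auto
  have "perm_weight m n u v p = (\<Sum>i\<in>unmatched. weight m (u i - v (p i)))"
    unfolding perm_weight_def
    by (rule sum.mono_neutral_right) (use sub minimal_matched[OF p] in \<open>auto simp: weight_def\<close>)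
  also have "\<dots> = (\<Sum>i\<in>unmatched. m + nat (u i - v (p i)) ^ 2)"
  proof (rule sum.cong[OF refl])
    fix i assume i: "i \<in> unmatched"
    then have "i < n" using sub by auto
    then have "v (p i) \<noteq> u i" using i permutes_less_upt[OF perm \<open>i < n\<close>] unfolding unmatched_def by force
    then show "weight m (u i - v (p i)) = m + nat (u i - v (p i)) ^ 2"
      using le[OF \<open>i < n\<close>] unfolding weight_def by simp
  qed
  also have "\<dots> = m * card unmatched + (\<Sum>i\<in>unmatched. nat (u i - v (p i)) ^ 2)"
    by (simp add: sum.distrib)
  finally have eq: "perm_weight m n u v p = m * card unmatched + (\<Sum>i\<in>unmatched. nat (u i - v (p i)) ^ 2)" .
  have "(\<Sum>i\<in>unmatched. nat (u i - v (p i)) ^ 2) \<le> (\<Sum>i\<in>unmatched. K\<^sup>2)"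
  proof (intro sum_mono power_mono)
    fix i assume "i \<in> unmatched"
    then have "i < n" using sub by auto
    then show "nat (u i - v (p i)) \<le> K"
      using diff_le[OF \<open>i < n\<close> permutes_less_upt[OF perm \<open>i < n\<close>]] by simp
  qed simp
  also have "\<dots> \<le> n * K\<^sup>2"
    using card_mono[OF _ sub] by simp
  finally have "(\<Sum>i\<in>unmatched. nat (u i - v (p i)) ^ 2) < m" using m_large(1) by simp
  then show ?thesis unfolding eq by simp
qed

section \<open>The specialised determinant as a polynomial in \<open>s\<close> and its lowest
  term\<close>

definition weight_poly :: "complex poly" where
  "weight_poly = (\<Sum>p\<in>feasible n u v. monom (of_int (sign p)) (perm_weight m n u v p))"

lemma coeff_weight_poly:
  "coeff weight_poly k = (\<Sum>p\<in>feasible n u v. if perm_weight m n u v p = k then of_int (sign p) else 0)"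
  unfolding weight_poly_def by (simp add: coeff_sum)

text \<open>Any feasible permutation of the same weight is itself minimal, hence equal to
  \<open>p\<close>. Nothing cancels, and the coefficient is the sign of \<open>p\<close>.\<close>

lemma least_coeff_weight_poly:
  assumes p: "minimal p"
  shows "coeff weight_poly (perm_weight m n u v p) \<noteq> 0"
    "k < perm_weight m n u v p \<Longrightarrow> coeff weight_poly k = 0"
proof -
  have uniq: "q = p" if "q \<in> feasible n u v" "perm_weight m n u v q = perm_weight m n u v p" for q
    by (rule minimal_unique[OF _ p]) (use that p in \<open>auto simp: minimal_def\<close>)
  have "coeff weight_poly (perm_weight m n u v p) = (\<Sum>q\<in>feasible n u v. if q = p then of_int (sign p) else 0)"
    unfolding coeff_weight_poly using uniq by (intro sum.cong) auto
  also have "\<dots> = of_int (sign p)"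
    using p finite_feasible unfolding minimal_def by simp
  finally show "coeff weight_poly (perm_weight m n u v p) \<noteq> 0"
    by (simp add: sign_def)
  show "coeff weight_poly k = 0" if "k < perm_weight m n u v p"
    unfolding coeff_weight_poly using p that unfolding minimal_def
    by (intro sum.neutral) (auto simp: not_le[symmetric])
qed

text \<open>Infeasible permutations drop out through a factor of negative index; all other indices
  lie in the range up to \<open>K\<close> where \<open>f\<close> is prescribed.\<close>

lemma poly_weight_poly:
  assumes neg: "\<And>k. k < 0 \<Longrightarrow> f k = 0" and f: "\<And>k. 0 \<le> k \<Longrightarrow> k \<le> int K \<Longrightarrow> f k = s ^ weight m k"
  shows "poly weight_poly s = jt_det f n u v"
proof -
  have "jt_det f n u v = (\<Sum>p\<in>feasible n u v. signof p * (\<Prod>i = 0..<n. f (u i - v (p i))))"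
    unfolding jt_det_sum
  proof (rule sum.mono_neutral_right)
    show "\<forall>p\<in>{p. p permutes {0..<n}} - feasible n u v. signof p * (\<Prod>i = 0..<n. f (u i - v (p i))) = 0"
    proof
      fix p assume "p \<in> {p. p permutes {0..<n}} - feasible n u v"
      then obtain i where "i < n" "u i - v (p i) < 0" unfolding feasible_def by force
      then have "f (u i - v (p i)) = 0" "i \<in> {0..<n}" using neg by simp_all
      then have "(\<Prod>i = 0..<n. f (u i - v (p i))) = 0" by (intro prod_zero) blast+
      then show "signof p * (\<Prod>i = 0..<n. f (u i - v (p i))) = 0" by simp
    qed
  qed (auto simp: feasible_def finite_permutations)
  also have "\<dots> = (\<Sum>p\<in>feasible n u v. signof p * s ^ perm_weight m n u v p)"
  proof (intro sum.cong refl arg_cong2[where f = "(*)"])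
    fix p assume p: "p \<in> feasible n u v"
    have "f (u i - v (p i)) = s ^ weight m (u i - v (p i))" if "i \<in> {0..<n}" for i
      using p that diff_le[of i "p i"] permutes_less_upt[of p n i] by (intro f) (auto simp: feasible_def)
    then show "(\<Prod>i = 0..<n. f (u i - v (p i))) = s ^ perm_weight m n u v p"
      unfolding perm_weight_def by (simp add: power_sum)
  qed
  also have "\<dots> = poly weight_poly s"
    unfolding weight_poly_def by (simp add: poly_sum poly_monom)
  finally show ?thesis by simp
qed

end

lemma card_unmatched_eq:
  assumes 1: "beta_pair n1 u1 v1 K m" and 2: "beta_pair n2 u2 v2 K m"
    and eq: "beta_pair.weight_poly n1 u1 v1 m = beta_pair.weight_poly n2 u2 v2 m"
  shows "card (beta_pair.unmatched n1 u1 v1) = card (beta_pair.unmatched n2 u2 v2)"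
proof -
  interpret A: beta_pair n1 u1 v1 K m by (rule 1)
  interpret B: beta_pair n2 u2 v2 K m by (rule 2)
  obtain p q where p: "A.minimal p" and q: "B.minimal q" using A.ex_minimal B.ex_minimal by blast
  have "perm_weight m n1 u1 v1 p = perm_weight m n2 u2 v2 q"
    using A.least_coeff_weight_poly[OF p] B.least_coeff_weight_poly[OF q] eq
    by (metis linorder_neqE_nat)
  then show ?thesis using A.perm_weight_minimal[OF p] B.perm_weight_minimal[OF q] by simp
qed

section \<open>Invariance of the Frobenius rank\<close>

text \<open>Diagonal \<open>e\<close> meets column \<open>j\<close> exactly when
  \<open>beta b j \<le> e < beta a j\<close>, so its length is a difference of two counts. From
  \<open>e\<close> to \<open>e + 1\<close> the length falls by one if \<open>e + 1\<close> is in
  \<open>A\<close>, and rises by one if it is in \<open>B\<close>.\<close>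

lemma descent_rank_columns_diagram:
  assumes a: "antimono_on {..<n} a" and b: "antimono_on {..<n} b" and ba: "\<And>j. j < n \<Longrightarrow> b j \<le> a j"
  shows "descent_rank (columns_diagram n a b) = card {i. i < n \<and> beta a i \<notin> beta b ` {0..<n}}"
proof -
  let ?D = "columns_diagram n a b"
  define A where "A = beta a ` {..<n}"
  define B where "B = beta b ` {..<n}"
  have up: "card {j. j < n \<and> e < beta c j} = card {j. j < n \<and> e + 1 < beta c j} + (if e + 1 \<in> beta c ` {..<n} then 1 else 0)"
    if c: "antimono_on {..<n} c" for c e
  proof -
    have "{j. j < n \<and> e < beta c j} = {j. j < n \<and> beta c j = e + 1} \<union> {j. j < n \<and> e + 1 < beta c j}"
      by auto
    then have "card {j. j < n \<and> e < beta c j} = card {j. j < n \<and> beta c j = e + 1} + card {j. j < n \<and> e + 1 < beta c j}"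
      by (simp add: card_Un_disjoint disjoint_iff)
    moreover have "card {j. j < n \<and> beta c j = e + 1} = (if e + 1 \<in> beta c ` {..<n} then 1 else 0)"
    proof (cases "e + 1 \<in> beta c ` {..<n}")
      case True
      then obtain k where k: "k < n" "beta c k = e + 1" by auto
      have "j = k" if "j < n" "beta c j = e + 1" for j
        using inj_onD[OF inj_on_beta[OF c], of j k] that k by simp
      then have "{j. j < n \<and> beta c j = e + 1} = {k}" using k by blast
      then show ?thesis using True by simp
    next
      case False
      then have "{j. j < n \<and> beta c j = e + 1} = {}" by force
      then show ?thesis using False by simp
    qed
    ultimately show ?thesis by simp
  qed
  have diag: "diag_card ?D e + card {j. j < n \<and> e < beta b j} = card {j. j < n \<and> e < beta a j}" for e
  proof -
    have "bij_betw snd {c \<in> ?D. cell_content c = e} {j. j < n \<and> beta b j \<le> e \<and> e < beta a j}"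
    proof (rule bij_betw_byWitness[where f' = "\<lambda>j. (nat (e + int j), j)"])
    qed (auto simp: columns_diagram_def beta_def)
    then have "diag_card ?D e = card {j. j < n \<and> beta b j \<le> e \<and> e < beta a j}"
      unfolding diag_card_def by (rule bij_betw_same_card)
    moreover have "{j. j < n \<and> e < beta a j} = {j. j < n \<and> beta b j \<le> e \<and> e < beta a j} \<union> {j. j < n \<and> e < beta b j}"
      using ba unfolding beta_def by fastforce
    moreover have "card ({j. j < n \<and> beta b j \<le> e \<and> e < beta a j} \<union> {j. j < n \<and> e < beta b j})
        = card {j. j < n \<and> beta b j \<le> e \<and> e < beta a j} + card {j. j < n \<and> e < beta b j}"
      by (rule card_Un_disjoint) auto
    ultimately show ?thesis by simp
  qed
  \<comment> \<open>The positions of the descents; the shift by one arises because the last cell of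
    a nonempty column \<open>j\<close> has content \<open>beta a j - 1\<close>.\<close>
  define X where "X = (\<lambda>e. e - 1) ` (A - B)"
  have X: "e \<in> X \<longleftrightarrow> e + 1 \<in> A \<and> e + 1 \<notin> B" for e unfolding X_def by force
  have step: "diag_card ?D e - diag_card ?D (e + 1) = (if e \<in> X then 1 else 0)" for e
    using up[OF a, of e] up[OF b, of e] diag[of e] diag[of "e + 1"] unfolding X A_def B_def
    by (auto split: if_splits)
  have finX: "finite X" unfolding X_def A_def by simp
  have "descent_rank ?D = (\<Sum>e\<in>cell_content ` ?D \<union> X. if e \<in> X then 1 else 0)"
    by (subst descent_rank_superset[of "cell_content ` ?D \<union> X"]) (simp_all add: finX step)
  also have "\<dots> = card ((cell_content ` ?D \<union> X) \<inter> X)"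
    using finX by (simp add: sum.If_cases)
  also have "(cell_content ` ?D \<union> X) \<inter> X = X" by blast
  also have "card X = card (A - B)" unfolding X_def by (rule card_image) (simp add: inj_on_def)
  also have "A - B = beta a ` {i. i < n \<and> beta a i \<notin> beta b ` {0..<n}}"
    unfolding A_def B_def by (auto simp: atLeast0LessThan)
  also have "card \<dots> = card {i. i < n \<and> beta a i \<notin> beta b ` {0..<n}}"
    by (rule card_image, rule inj_on_subset[OF inj_on_beta[OF a]]) auto
  finally show ?thesis .
qed

lemma frobenius_rank_skew_equivalent:
  assumes D1: "skew_diagram D1" and D2: "skew_diagram D2" and eq: "skew_equivalent D1 D2"
  shows "frobenius_rank D1 = frobenius_rank D2"
proof -
  obtain n1 a1 b1 where 1: "antimono a1" "antimono b1" "b1 \<le> a1" "D1 = columns_diagram n1 a1 b1"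
    by (rule skew_diagram_columns[OF D1])
  obtain n2 a2 b2 where 2: "antimono a2" "antimono b2" "b2 \<le> a2" "D2 = columns_diagram n2 a2 b2"
    by (rule skew_diagram_columns[OF D2])
  have on: "antimono_on {..<n} c" if "antimono c" for n and c :: "nat \<Rightarrow> nat"
    using that by (rule monotone_on_subset) simp
  \<comment> \<open>Bounds \<open>beta a i - beta b j\<close> for both diagrams, and also serves as
    the number of variables, so that all elementary symmetric polynomials up to index
    \<open>K\<close> can be prescribed.\<close>
  define K where "K = a1 0 + a2 0 + n1 + n2"
  define m where "m = (n1 + n2 + 2) * K\<^sup>2 + 1"
  have pair: "beta_pair n (beta a) (beta b) K m"
    if ab: "antimono a" "antimono b" "b \<le> a" and le: "a 0 + n \<le> K" "n \<le> n1 + n2" for n a b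
  proof
    show "beta a k < beta a i" "beta b k < beta b i" if "i < k" "k < n" for i k
      using that beta_strict_decreasing[OF on] ab by blast+
    show "beta b i \<le> beta a i" for i using le_funD[OF ab(3)] unfolding beta_def by simp
    show "beta a i - beta b j \<le> int K" if "i < n" "j < n" for i j
      using antimonoD[OF ab(1), of 0 i] that le unfolding beta_def by simp
    have "n * K\<^sup>2 \<le> (n1 + n2 + 2) * K\<^sup>2" using le by (intro mult_right_mono) auto
    then show "n * K\<^sup>2 < m" unfolding m_def by simp
    have "2 * K\<^sup>2 \<le> (n1 + n2 + 2) * K\<^sup>2" by (intro mult_right_mono) auto
    then show "2 * K\<^sup>2 < m" unfolding m_def by simp
  qed
  have P1: "beta_pair n1 (beta a1) (beta b1) K m" and P2: "beta_pair n2 (beta a2) (beta b2) K m"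
    using pair[OF 1(1-3)] pair[OF 2(1-3)] unfolding K_def by simp_all
  interpret A: beta_pair n1 "beta a1" "beta b1" K m by (rule P1)
  interpret B: beta_pair n2 "beta a2" "beta b2" K m by (rule P2)
  have "poly A.weight_poly s = poly B.weight_poly s" for s
  proof -
    \<comment> \<open>The target values of the elementary symmetric polynomials as coefficients; the
      constant term is \<open>1\<close> because \<open>weight m 0 = 0\<close>. The resulting
      \<open>x\<close> depends on \<open>s\<close> but is shared by both diagrams.\<close>
    define p where "p = (\<Sum>k\<le>K. monom (s ^ weight m (int k)) k)"
    have coeff: "coeff p k = (if k \<le> K then s ^ weight m (int k) else 0)" for k
      unfolding p_def by (simp add: coeff_sum)
    have "coeff p 0 = 1" unfolding coeff by (simp add: weight_def)
    moreover have "degree p \<le> K" by (rule degree_le) (simp add: coeff)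
    ultimately obtain x where x: "\<And>k. esym x K (int k) = coeff p k" using esym_surj by blast
    have ex: "esym x K k = s ^ weight m k" if "0 \<le> k" "k \<le> int K" for k
      using x[of "nat k"] that by (simp add: coeff)
    have "poly A.weight_poly s = jt_det (esym x K) n1 (beta a1) (beta b1)"
      by (rule A.poly_weight_poly[OF esym_neg ex])
    also have "\<dots> = (\<Sum>T\<in>bounded_fillings D1 K. \<Prod>c\<in>D1. x (T c))"
      unfolding 1(4) using 1(3) by (intro dual_jacobi_trudi[symmetric] on 1) (simp add: le_funD)
    also have "\<dots> = (\<Sum>T\<in>bounded_fillings D2 K. \<Prod>c\<in>D2. x (T c))"
      by (rule skew_equivalent_eval[OF _ _ eq]) (use 1(4) 2(4) in simp_all)
    also have "\<dots> = jt_det (esym x K) n2 (beta a2) (beta b2)"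
      unfolding 2(4) using 2(3) by (intro dual_jacobi_trudi on 2) (simp add: le_funD)
    also have "\<dots> = poly B.weight_poly s"
      by (rule B.poly_weight_poly[OF esym_neg ex, symmetric])
    finally show ?thesis .
  qed
  then have "A.weight_poly = B.weight_poly"
    by (simp add: poly_eq_poly_eq_iff[symmetric] fun_eq_iff)
  then have "card A.unmatched = card B.unmatched" by (rule card_unmatched_eq[OF P1 P2])
  then have "descent_rank D1 = descent_rank D2"
    unfolding 1(4) 2(4) A.unmatched_def B.unmatched_def
    using descent_rank_columns_diagram[OF on[OF 1(1)] on[OF 1(2)] le_funD[OF 1(3)]]
      descent_rank_columns_diagram[OF on[OF 2(1)] on[OF 2(2)] le_funD[OF 2(3)]] by simp
  then show ?thesis
    using frobenius_rank_eq_descent_rank[OF D1] frobenius_rank_eq_descent_rank[OF D2] by simp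
qed

theorem corollary8p1:
  "(\<forall>D1 D2. skew_diagram D1 \<longrightarrow> skew_diagram D2 \<longrightarrow> skew_equivalent D1 D2 \<longrightarrow>
      frobenius_rank D1 = frobenius_rank D2) \<and>
   (\<forall>D R. skew_diagram D \<longrightarrow> ribbon R \<longrightarrow> skew_equivalent D R \<longrightarrow> ribbon D) \<and>
   (\<forall>D. skew_diagram D \<longrightarrow> (ribbon D \<longleftrightarrow> frobenius_rank D = 1))"
proof (intro conjI allI impI)
  fix D R assume "skew_diagram D" "ribbon R" "skew_equivalent D R"
  moreover from this have "skew_diagram R" unfolding ribbon_def by blast
  ultimately show "ribbon D"
    using frobenius_rank_skew_equivalent ribbon_iff_frobenius_rank_1 by metis
qed (simp_all add: frobenius_rank_skew_equivalent ribbon_iff_frobenius_rank_1)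

end
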